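(* Consider SAEF-SGD with momentum (step-ahead error feedback with momentum constant $0\le\mu<1$, without error averaging, with double-way compression, as defined in the context) run for $T\ge1$ iterations with $K\ge1$ workers. Suppose Assumptions (A1) ($L$-Lipschitz gradient), (A2) (bounded variance), (A3) (bounded gradient) and (A4) ($\delta$-approximate compressor) of the context hold, and that the learning rate is constant, $\eta_t=\eta>0$ for all $t=0,\dots,T-1$, and satisfies $$\alpha:=1-\frac{\eta L}{1-\mu}-\frac{2\mu^2\eta^2L^2}{(1-\mu)^4}>0.$$ Let $C=\frac{2(1+\delta)(2-\delta)}{(1-\sqrt{1-\delta})^2}+\frac{1+\delta}{\delta}$. Then, for every worker $k$, $$\min_{t=0,\dots,T-1}\mathbb{E}\|\nabla F(x^{(k)}_t)\|_2^2\le\frac{4(1-\mu)[F(x_0)-F(x^* )]}{\alpha\eta T}+\frac{2\left(1+\frac{2\mu^2\eta L}{(1-\mu)^3}\right)\eta L\sigma^2}{\alpha(1-\mu)K}+(4C+2\alpha)\frac{1-\delta}{(1-\sqrt{1-\delta})^2}\,\frac{\eta^2L^2(M^2+\sigma^2)}{\alpha(1-\mu)^2},$$ and $$\min_{t=0,\dots,T-1}\mathbb{E}\|\nabla F(\tilde{x}_t)\|_2^2\le\frac{4(1-\mu)[F(x_0)-F(x^* )]}{\alpha\eta T}+\frac{2\left(1+\frac{2\mu^2\eta L}{(1-\mu)^3}\right)\eta L\sigma^2}{\alpha(1-\mu)K}+\left(\frac4\alpha+2\right)\frac{C(1-\delta)}{(1-\sqrt{1-\delta})^2}\,\frac{\e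ta^2L^2(M^2+\sigma^2)}{(1-\mu)^2}.$$
   Context: Problem: minimize $F(x)=\mathbb{E}_{\xi\sim\mathcal{D}}f(x;\xi)$ over $x\in\mathbb{R}^d$, with unbiased stochastic gradients $\mathbb{E}_{\xi\sim\mathcal D}\nabla f(x;\xi)=\nabla F(x)$; $x^*$ denotes a minimizer of $F$. All $K$ workers sample from the same distribution $\mathcal{D}$; the samples $\xi^{(k)}_t$ ($1\le k\le K$, $0\le t\le T-1$) are independent with law $\mathcal D$. SAEF-SGD with momentum (no error averaging). Let $\mathcal{C}:\mathbb{R}^d\to\mathbb{R}^d$ be a compression function, $0\le\mu<1$, and $\eta_t>0$ the learning rates. Start from a given $x_0\in\mathbb{R}^d$, local errors $e^{(k)}_0=0$ and momentum buffers $m^{(k)}_0=0$ for $1\le k\le K$, and server error $e_0=0$. All workers hold the same model $x^{(k)}_t=x_t$. For $t=0,\dots,T-1$: each worker $k$ computes $x^{(k)}_{t+\frac12}=x_t-e^{(k)}_t$, $m^{(k)}_{t+1}=\mu m^{(k)}_t+\nabla f(x^{(k)}_{t+\frac12};\xi^{(k)}_t)$, $\Delta^{(k)}_{t+1}=e^{(k)}_t+\eta_t m^{(k)}_{t+1}$, $e^{(k)}_{t+1}=\Delta^{(k)}_{t+1}-\mathcal{C}(\Delta^{(k)}_{t+1})$; the server computes $\Delta_{t+1}=e_t+\frac1K\sum_{k=1}^K\mathcal{C}(\Delta^{(k)}_{t+1})$, $e_{t+1}=\Delta_{t+1}-\mathcal{C}(\Delta_{t+1})$; then $x_{t+1}=x_t-\mathcal{C}(\Delta_{t+1})$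 for all workers. Auxiliary variable: $\tilde{x}_t=x_t-\big(e_t+\frac1K\sum_{k=1}^K e^{(k)}_t\big)$. Assumptions. (A1) $F$ is differentiable and $\|\nabla F(x)-\nabla F(y)\|_2\le L\|x-y\|_2$ for all $x,y\in\mathbb{R}^d$. (A2) $\mathbb{E}\|\nabla f(x;\xi^{(k)}_t)-\nabla F(x)\|_2^2\le\sigma^2$ at the iterates $x=x^{(k)}_t$ and $x=x^{(k)}_{t+\frac12}$, for all $k,t$. (A3) $\|\nabla F(x)\|_2^2\le M^2$ at the iterates $x=x^{(k)}_t$ and $x=x^{(k)}_{t+\frac12}$, for all $k,t$. (A4) $0<\delta\le1$ and $\|\mathcal{C}(v)-v\|_2^2\le(1-\delta)\|v\|_2^2$ for all $v\in\mathbb{R}^d$. *)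

theory Defs
  imports "HOL-Probability.Probability"
begin

record 'v saef_state =
  model :: 'v
  worker_err :: "nat \<Rightarrow> 'v"
  worker_mom :: "nat \<Rightarrow> 'v"
  server_err :: 'v

text \<open>Workers are indexed by \<open>1..K\<close>; the values of \<open>worker_err\<close> and
  \<open>worker_mom\<close> at other indices are irrelevant. Every worker holds the same model
  \<open>x\<^sub>t\<close>, so \<open>worker_model s k\<close> does not depend on \<open>k\<close>.\<close>

definition worker_model :: "'v saef_state \<Rightarrow> nat \<Rightarrow> 'v" where
  "worker_model s k = model s"

text \<open>The step-ahead point (time \<open>t + 1/2\<close>) at which worker \<open>k\<close> evaluates its
  stochastic gradient.\<close>

definition half_model :: "'v::real_vector saef_state \<Rightarrow> nat \<Rightarrow> 'v" where
  "half_model s k = worker_model s k - worker_err s k"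

definition aux_model :: "nat \<Rightarrow> 'v::real_vector saef_state \<Rightarrow> 'v" where
  "aux_model K s =
     model s - (server_err s + (1 / real K) *\<^sub>R (\<Sum>k = 1..K. worker_err s k))"

definition saef_init :: "'v::real_vector \<Rightarrow> 'v saef_state" where
  "saef_init x0 =
     \<lparr>model = x0, worker_err = (\<lambda>k. 0), worker_mom = (\<lambda>k. 0), server_err = 0\<rparr>"

text \<open>One iteration with compressor \<open>Q\<close>, momentum constant \<open>\<mu>\<close> and learning rate
  \<open>\<eta>\<close>; \<open>g k\<close> is the stochastic gradient field sampled by worker \<open>k\<close>.\<close>

definition saef_step ::
  "('v \<Rightarrow> 'v) \<Rightarrow> real \<Rightarrow> nat \<Rightarrow> real \<Rightarrow> (nat \<Rightarrow> 'v \<Rightarrow> 'v) \<Rightarrow> 'v::real_vector saef_state \<Rightarrow> 'v saef_state"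
where
  "saef_step Q \<mu> K \<eta> g s =
    (let m = (\<lambda>k. \<mu> *\<^sub>R worker_mom s k + g k (half_model s k));
         \<Delta>w = (\<lambda>k. worker_err s k + \<eta> *\<^sub>R m k);
         \<Delta> = server_err s + (1 / real K) *\<^sub>R (\<Sum>k = 1..K. Q (\<Delta>w k))
     in \<lparr>model = model s - Q \<Delta>,
         worker_err = (\<lambda>k. \<Delta>w k - Q (\<Delta>w k)),
         worker_mom = m,
         server_err = \<Delta> - Q \<Delta>\<rparr>)"

primrec saef_sgd ::
  "('v \<Rightarrow> 'v) \<Rightarrow> real \<Rightarrow> nat \<Rightarrow> (nat \<Rightarrow> real) \<Rightarrow> (nat \<Rightarrow> nat \<Rightarrow> 'v \<Rightarrow> 'v) \<Rightarrow> 'v::real_vector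
     \<Rightarrow> nat \<Rightarrow> 'v saef_state"
where
  "saef_sgd Q \<mu> K \<eta> g x0 0 = saef_init x0"
| "saef_sgd Q \<mu> K \<eta> g x0 (Suc t) = saef_step Q \<mu> K (\<eta> t) (g t) (saef_sgd Q \<mu> K \<eta> g x0 t)"

end

(* Put z_t = x~_t - (mu eta/(1-mu)) m_t, where m_t is the average of the momentum buffers. The compression
   errors telescope out of x~_t, and z_{t+1} = z_t - gamma g_t with gamma = eta/(1-mu) and g_t the averaged
   stochastic gradient, so z_t performs plain SGD except that gradients are taken at the step-ahead points.
   The descent lemma at z_t therefore controls the mean of |grad F|^2 over the step-ahead points, up to the
   squared distances |z_t - x~_t| (a multiple of |m_t|, absorbed by adding a multiple of E|m_t|^2 to the
   potential E F(z_t)) and |x~_t - x_{t+1/2}| (the compression errors). The latter are bounded in mean square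
   because the compressor contracts by sqrt(1-delta): |u| <= s|w| implies
   |u + v|^2 <= s|w|^2 + |v|^2/(1-s), and this recursion preserves the bound a/(1-s)^2 when E|v|^2 <= a.
   Both claims follow since x_t and x~_t are close to the step-ahead points. *)

theory Submission
  imports Defs
begin

subsection \<open>Measurability of parametrised gradients\<close>

text \<open>Only each \<open>f x\<close> is given as measurable, while gradients are evaluated at
  random points, so joint measurability of \<open>grad_f\<close> in point and sample has to be
  derived first. A Bochner integral of a non-integrable function is 0, so finiteness of all second
  moments precedes any bound on them. Conditional expectations are avoided: a random vector is
  adapted to a set of (worker, time) pairs if it is a measurable function of these samples, and the
  noise is orthogonal to it by independence of disjoint sample families and Fubini. Arbitrary index
  sets also cover two workers in the same round, which produces the factor 1/K in the variance term.
  The constants: the momentum weight in the potential is the one that a round reproduces; the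
  squared gradients are then left with a coefficient proportional to \<alpha>. In \<open>C\<close>,
  the factor 2-\<delta> bounds the compressed mean feeding the server error, and 1+\<delta> and
  (1+\<delta>)/\<delta> come from Young's inequality with parameter \<delta>. Each factor 4 is a 2
  from the descent bound times a 2 from comparing gradients at nearby points.\<close>

lemma caratheodory_borel_measurable:
  fixes f :: "'x::{metric_space, second_countable_topology} \<Rightarrow> 'z \<Rightarrow> 'b::metric_space"
  assumes meas: "\<And>x. f x \<in> borel_measurable D"
    and cont: "\<And>z. z \<in> space D \<Longrightarrow> continuous_on UNIV (\<lambda>x. f x z)"
  shows "(\<lambda>p. f (fst p) (snd p)) \<in> borel_measurable (borel \<Otimes>\<^sub>M D)"
proof -
  obtain A :: "'x set" where A: "countable A" "\<And>X. open X \<Longrightarrow> X \<noteq> {} \<Longrightarrow> \<exists>d\<in>A. d \<in> X"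
    using countable_dense_exists by metis
  have "A \<noteq> {}" using A(2)[of UNIV] by auto
  define d where "d = from_nat_into A"
  have dense: "\<exists>i. dist (d i) x < e" if "e > 0" for x e
  proof -
    have "ball x e \<noteq> {}" using that by simp
    then obtain a where "a \<in> A" "a \<in> ball x e" using A(2)[OF open_ball] by blast
    then show ?thesis
      unfolding d_def using A(1) \<open>A \<noteq> {}\<close>
      by (metis dist_commute from_nat_into_surj mem_ball)
  qed
  \<comment> \<open>Taking the least admissible index makes the choice of the approximating point
    measurable: it depends on countably many distance comparisons.\<close>
  define idx where "idx n x = (LEAST i. dist (d i) x < 1 / real (Suc n))" for n x
  have idx: "dist (d (idx n x)) x < 1 / real (Suc n)" for n x
    unfolding idx_def by (rule LeastI_ex) (intro dense, simp)
  have [measurable]: "idx n \<in> borel \<rightarrow>\<^sub>M count_space UNIV" for n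
    unfolding idx_def by measurable
  \<comment> \<open>Round \<open>x\<close> to a point of the dense sequence \<open>d\<close>; the rounded function takes countably many branches.\<close>
  show ?thesis
  proof (rule borel_measurable_LIMSEQ_metric)
    fix n
    show "(\<lambda>p. f (d (idx n (fst p))) (snd p)) \<in> borel_measurable (borel \<Otimes>\<^sub>M D)"
      by (rule measurable_compose_countable[where f = "\<lambda>i p. f (d i) (snd p)"])
        (use meas in measurable)
  next
    fix p :: "'x \<times> 'z" assume "p \<in> space (borel \<Otimes>\<^sub>M D)"
    then have "snd p \<in> space D" by (auto simp: space_pair_measure)
    have "(\<lambda>n. d (idx n (fst p))) \<longlonglongrightarrow> fst p"
    proof (rule metric_LIMSEQ_I)
      fix e :: real assume "e > 0"
      then obtain N where N: "1 / real (Suc N) < e" using nat_approx_posE by blast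
      have "dist (d (idx n (fst p))) (fst p) < e" if "n \<ge> N" for n
      proof -
        have "1 / real (Suc n) \<le> 1 / real (Suc N)" using that by (simp add: frac_le)
        then show ?thesis using idx[of n "fst p"] N by linarith
      qed
      then show "\<exists>no. \<forall>n\<ge>no. dist (d (idx n (fst p))) (fst p) < e" by blast
    qed
    then show "(\<lambda>n. f (d (idx n (fst p))) (snd p)) \<longlonglongrightarrow> f (fst p) (snd p)"
      using cont[OF \<open>snd p \<in> space D\<close>]
      by (auto intro: continuous_on_tendsto_compose)
  qed
qed

text \<open>A component of a gradient becomes a limit along a fixed sequence, the form in which
  measurability passes to the limit.\<close>

lemma GDERIV_directional_limit:
  assumes "GDERIV f x :> g"
  shows "(\<lambda>n. (f (x + (1 / real (Suc n)) *\<^sub>R b) - f x) / (1 / real (Suc n))) \<longlonglongrightarrow> b \<bullet> g"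
proof -
  have "((\<lambda>t. f (x + t *\<^sub>R b)) has_derivative (\<lambda>t. (t *\<^sub>R b) \<bullet> g)) (at 0)"
  proof (rule has_derivative_compose[where g = f and f = "\<lambda>t. x + t *\<^sub>R b"])
    show "((\<lambda>t. x + t *\<^sub>R b) has_derivative (\<lambda>t. t *\<^sub>R b)) (at 0)"
      by (auto intro!: derivative_eq_intros)
    show "(f has_derivative (\<lambda>h. h \<bullet> g)) (at (x + 0 *\<^sub>R b))"
      using assms by (simp add: gderiv_def)
  qed
  then have "((\<lambda>t. f (x + t *\<^sub>R b)) has_field_derivative (b \<bullet> g)) (at 0)"
    by (simp add: has_field_derivative_def mult_commute_abs)
  then have "(\<lambda>h. (f (x + h *\<^sub>R b) - f x) / h) \<midarrow>0\<rightarrow> b \<bullet> g"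
    by (simp add: DERIV_def)
  moreover have "filterlim (\<lambda>n. 1 / real (Suc n)) (at 0) sequentially"
    using LIMSEQ_inverse_real_of_nat by (intro filterlim_atI) (simp_all add: inverse_eq_divide)
  ultimately show ?thesis
    by (rule filterlim_compose)
qed

text \<open>Differentiability gives continuity in the point, so \<open>f\<close> is jointly
  measurable by the Caratheodory argument. Its difference quotients inherit this, and their limits
  are the components of the gradient.\<close>

lemma gradient_borel_measurable:
  fixes f :: "'v::euclidean_space \<Rightarrow> 'z \<Rightarrow> real"
  assumes meas: "\<And>x. f x \<in> borel_measurable D"
    and grad: "\<And>x z. z \<in> space D \<Longrightarrow> GDERIV (\<lambda>y. f y z) x :> g x z"
  shows "(\<lambda>p. g (fst p) (snd p)) \<in> borel_measurable (borel \<Otimes>\<^sub>M D)"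
proof -
  have "continuous_on UNIV (\<lambda>x. f x z)" if "z \<in> space D" for z
    using grad[OF that] unfolding gderiv_def
    by (meson continuous_at_imp_continuous_on has_derivative_continuous)
  then have joint: "(\<lambda>p. f (fst p) (snd p)) \<in> borel_measurable (borel \<Otimes>\<^sub>M D)"
    by (intro caratheodory_borel_measurable meas)
  have "(\<lambda>p. b \<bullet> g (fst p) (snd p)) \<in> borel_measurable (borel \<Otimes>\<^sub>M D)" for b
  proof (rule borel_measurable_LIMSEQ_metric)
    fix n
    have "(\<lambda>p. f (fst p + (1 / real (Suc n)) *\<^sub>R b) (snd p)) \<in> borel_measurable (borel \<Otimes>\<^sub>M D)"
      using measurable_compose[OF _ joint,
          of "\<lambda>p. (fst p + (1 / real (Suc n)) *\<^sub>R b, snd p)" "borel \<Otimes>\<^sub>M D"] by simp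
    then show "(\<lambda>p. (f (fst p + (1 / real (Suc n)) *\<^sub>R b) (snd p) - f (fst p) (snd p))
        / (1 / real (Suc n))) \<in> borel_measurable (borel \<Otimes>\<^sub>M D)"
      using joint by measurable
  next
    fix p :: "'v \<times> 'z" assume "p \<in> space (borel \<Otimes>\<^sub>M D)"
    then have "snd p \<in> space D" by (auto simp: space_pair_measure)
    then show "(\<lambda>n. (f (fst p + (1 / real (Suc n)) *\<^sub>R b) (snd p) - f (fst p) (snd p))
        / (1 / real (Suc n))) \<longlonglongrightarrow> b \<bullet> g (fst p) (snd p)"
      by (intro GDERIV_directional_limit grad)
  qed
  then show ?thesis
    by (subst borel_measurable_euclidean_space) (simp add: inner_commute)
qed

subsection \<open>Inequalities for vectors and gradients\<close>

text \<open>Subtracting the quadratic majorant from \<open>F\<close> along the segment leaves a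
  function with nonpositive derivative on [0,1]; no integral of the gradient is formed.\<close>

lemma lipschitz_gradient_descent:
  fixes F :: "'v::real_inner \<Rightarrow> real"
  assumes grad: "\<And>x. GDERIV F x :> G x"
    and lip: "\<And>x y. norm (G x - G y) \<le> L * norm (x - y)"
  shows "F (x + d) \<le> F x + G x \<bullet> d + L / 2 * (norm d)\<^sup>2"
proof -
  define \<phi> where "\<phi> s = F (x + s *\<^sub>R d) - s * (G x \<bullet> d) - L / 2 * s\<^sup>2 * (norm d)\<^sup>2" for s
  have F: "((\<lambda>t. F (x + t *\<^sub>R d)) has_real_derivative (G (x + s *\<^sub>R d) \<bullet> d)) (at s)" for s
  proof -
    have "((\<lambda>t. F (x + t *\<^sub>R d)) has_derivative (\<lambda>t. (t *\<^sub>R d) \<bullet> G (x + s *\<^sub>R d))) (at s)"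
    proof (rule has_derivative_compose[where g = F and f = "\<lambda>t. x + t *\<^sub>R d"])
      show "((\<lambda>t. x + t *\<^sub>R d) has_derivative (\<lambda>t. t *\<^sub>R d)) (at s)"
        by (auto intro!: derivative_eq_intros)
      show "(F has_derivative (\<lambda>h. h \<bullet> G (x + s *\<^sub>R d))) (at (x + s *\<^sub>R d))"
        using grad by (simp add: gderiv_def)
    qed
    then show ?thesis
      by (simp add: has_field_derivative_def mult_commute_abs inner_commute)
  qed
  have deriv: "(\<phi> has_real_derivative (G (x + s *\<^sub>R d) \<bullet> d - G x \<bullet> d - L * s * (norm d)\<^sup>2)) (at s)" for s
    unfolding \<phi>_def by (auto intro!: derivative_eq_intros F)
  have "G (x + s *\<^sub>R d) \<bullet> d - G x \<bullet> d \<le> L * s * (norm d)\<^sup>2" if "0 \<le> s" for s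
  proof -
    have "G (x + s *\<^sub>R d) \<bullet> d - G x \<bullet> d = (G (x + s *\<^sub>R d) - G x) \<bullet> d" by (simp add: inner_diff_left)
    also have "\<dots> \<le> norm (G (x + s *\<^sub>R d) - G x) * norm d" by (rule norm_cauchy_schwarz)
    also have "\<dots> \<le> (L * norm (x + s *\<^sub>R d - x)) * norm d" by (intro mult_right_mono lip) simp
    also have "\<dots> = L * s * (norm d)\<^sup>2" using that by (simp add: power2_eq_square)
    finally show ?thesis .
  qed
  then have "\<phi> 1 \<le> \<phi> 0"
    by (intro DERIV_nonpos_imp_nonincreasing[of 0 1 \<phi>]) (auto intro: deriv)
  then show ?thesis by (simp add: \<phi>_def)
qed

text \<open>Convexity of the square at the points \<open>norm w\<close> and
  \<open>norm v / (1 - s)\<close> with weights \<open>s\<close> and \<open>1 - s\<close>.\<close>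

lemma norm_contraction_add_sq:
  fixes u v w :: "'v::real_normed_vector"
  assumes "norm u \<le> s * norm w" "0 \<le> s" "s < 1"
  shows "(norm (u + v))\<^sup>2 \<le> s * (norm w)\<^sup>2 + (norm v)\<^sup>2 / (1 - s)"
proof -
  define b where "b = norm v / (1 - s)"
  have v: "norm v = (1 - s) * b" using assms by (simp add: b_def)
  have "norm (u + v) \<le> s * norm w + (1 - s) * b"
    using norm_triangle_ineq[of u v] assms(1) v by linarith
  then have "(norm (u + v))\<^sup>2 \<le> (s * norm w + (1 - s) * b)\<^sup>2"
    by (intro power_mono) auto
  also have "\<dots> = s * (norm w)\<^sup>2 + (1 - s) * b\<^sup>2 - s * (1 - s) * (norm w - b)\<^sup>2"
    by (simp add: power2_eq_square algebra_simps)
  also have "\<dots> \<le> s * (norm w)\<^sup>2 + (1 - s) * b\<^sup>2" using assms by simp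
  also have "(1 - s) * b\<^sup>2 = (norm v)\<^sup>2 / (1 - s)"
    using assms by (simp add: v power2_eq_square)
  finally show ?thesis .
qed

text \<open>Young's inequality, from expanding the square of \<open>c *\<^sub>R u - v\<close>. The
  value \<open>c = 1\<close> gives the plain factors 2; \<open>c = \<delta>\<close> is used once, to
  split the gap.\<close>

lemma norm_add_sq_le_weighted:
  fixes u v :: "'v::real_inner"
  assumes "0 < c"
  shows "(norm (u + v))\<^sup>2 \<le> (1 + c) * (norm u)\<^sup>2 + (1 + 1 / c) * (norm v)\<^sup>2"
proof -
  have "0 \<le> (norm (c *\<^sub>R u - v))\<^sup>2 / c" using assms by simp
  also have "\<dots> = c * (norm u)\<^sup>2 + (norm v)\<^sup>2 / c - 2 * (u \<bullet> v)"
    using assms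
    by (simp add: power2_norm_eq_inner inner_diff_left inner_diff_right inner_commute field_simps)
  finally show ?thesis
    by (simp add: power2_norm_eq_inner algebra_simps inner_commute)
qed

text \<open>Bias-variance decomposition over the workers. Dropping the deviation gives Jensen's
  inequality for averages; dropping the mean shows that centring does not increase the sum of
  squares. Both consequences are used.\<close>

lemma norm_sq_mean_add_deviation:
  fixes u :: "nat \<Rightarrow> 'v::real_inner"
  assumes "1 \<le> K"
    and m: "m = (1 / real K) *\<^sub>R (\<Sum>k = 1..K. u k)"
  shows "(norm m)\<^sup>2 + (\<Sum>k = 1..K. (norm (m - u k))\<^sup>2) / K
    = (\<Sum>k = 1..K. (norm (u k))\<^sup>2) / K"
proof -
  have sum: "(\<Sum>k = 1..K. u k) = real K *\<^sub>R m" using assms by simp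
  have "(\<Sum>k = 1..K. (norm (m - u k))\<^sup>2) = (\<Sum>k = 1..K. (norm m)\<^sup>2 - 2 * (m \<bullet> u k) + (norm (u k))\<^sup>2)"
    by (simp add: power2_norm_eq_inner algebra_simps inner_commute)
  also have "\<dots> = real K * (norm m)\<^sup>2 - 2 * (m \<bullet> (\<Sum>k = 1..K. u k)) + (\<Sum>k = 1..K. (norm (u k))\<^sup>2)"
    by (simp add: sum.distrib sum_subtractf inner_sum_right sum_distrib_left)
  also have "\<dots> = (\<Sum>k = 1..K. (norm (u k))\<^sup>2) - real K * (norm m)\<^sup>2"
    unfolding sum by (simp add: power2_norm_eq_inner)
  finally show ?thesis using assms(1) by (simp add: field_simps)
qed

subsection \<open>Square-integrable random vectors\<close>

context prob_space
begin

text \<open>Measurability of the vector is demanded separately, because integrability of the squared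
  norm does not control the components.\<close>

definition square_integrable :: "('a \<Rightarrow> 'v::euclidean_space) \<Rightarrow> bool" where
  "square_integrable u \<longleftrightarrow> u \<in> borel_measurable M \<and> integrable M (\<lambda>\<omega>. (norm (u \<omega>))\<^sup>2)"

lemma square_integrable_measurable: "square_integrable u \<Longrightarrow> u \<in> borel_measurable M"
  by (simp add: square_integrable_def)

lemma square_integrable_norm: "square_integrable u \<Longrightarrow> integrable M (\<lambda>\<omega>. (norm (u \<omega>))\<^sup>2)"
  by (simp add: square_integrable_def)

lemma square_integrable_const: "square_integrable (\<lambda>\<omega>. c)"
  by (simp add: square_integrable_def)

text \<open>The affine bound covers the growth of a Lipschitz gradient as well as that of a
  compressor, so both preserve square integrability.\<close>

lemma square_integrable_dominated:
  assumes u: "u \<in> borel_measurable M" and v: "square_integrable v"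
    and le: "\<And>\<omega>. (norm (u \<omega>))\<^sup>2 \<le> a + c * (norm (v \<omega>))\<^sup>2"
  shows "square_integrable u"
  unfolding square_integrable_def
proof
  have "integrable M (\<lambda>\<omega>. a + c * (norm (v \<omega>))\<^sup>2)"
    using square_integrable_norm[OF v] by simp
  then show "integrable M (\<lambda>\<omega>. (norm (u \<omega>))\<^sup>2)"
  proof (rule Bochner_Integration.integrable_bound)
    show "(\<lambda>\<omega>. (norm (u \<omega>))\<^sup>2) \<in> borel_measurable M" using u by measurable
    have "norm ((norm (u \<omega>))\<^sup>2) \<le> norm (a + c * (norm (v \<omega>))\<^sup>2)" for \<omega>
      using order_trans[OF le abs_ge_self] by simp
    then show "AE \<omega> in M. norm ((norm (u \<omega>))\<^sup>2) \<le> norm (a + c * (norm (v \<omega>))\<^sup>2)"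
      by simp
  qed
qed (fact u)

lemma square_integrable_add:
  assumes u: "square_integrable u" and v: "square_integrable v"
  shows "square_integrable (\<lambda>\<omega>. u \<omega> + v \<omega>)"
  unfolding square_integrable_def
proof
  note [measurable] = assms[THEN square_integrable_measurable]
  show "(\<lambda>\<omega>. u \<omega> + v \<omega>) \<in> borel_measurable M" by measurable
  have "integrable M (\<lambda>\<omega>. 2 * (norm (u \<omega>))\<^sup>2 + 2 * (norm (v \<omega>))\<^sup>2)"
    using assms[THEN square_integrable_norm] by simp
  then show "integrable M (\<lambda>\<omega>. (norm (u \<omega> + v \<omega>))\<^sup>2)"
  proof (rule Bochner_Integration.integrable_bound)
    show "AE \<omega> in M. norm ((norm (u \<omega> + v \<omega>))\<^sup>2) \<le> norm (2 * (norm (u \<omega>))\<^sup>2 + 2 * (norm (v \<omega>))\<^sup>2)"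
      using norm_add_sq_le_weighted[of 1] by auto
  qed measurable
qed

lemma square_integrable_scaleR:
  assumes u: "square_integrable u"
  shows "square_integrable (\<lambda>\<omega>. c *\<^sub>R u \<omega>)"
  using square_integrable_measurable[OF u]
  by (intro square_integrable_dominated[OF _ u, of _ 0 "c\<^sup>2"]) (auto simp: power_mult_distrib)

lemma square_integrable_diff:
  assumes "square_integrable u" "square_integrable v"
  shows "square_integrable (\<lambda>\<omega>. u \<omega> - v \<omega>)"
  using square_integrable_add[OF assms(1) square_integrable_scaleR[OF assms(2), of "-1"]] by simp

lemma square_integrable_sum:
  assumes "\<And>i. i \<in> A \<Longrightarrow> square_integrable (u i)"
  shows "square_integrable (\<lambda>\<omega>. \<Sum>i\<in>A. u i \<omega>)"
  using assms
  by (induction A rule: infinite_finite_induct)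
    (auto intro: square_integrable_const square_integrable_add)

lemma square_integrable_inner:
  assumes u: "square_integrable u" and v: "square_integrable v"
  shows "integrable M (\<lambda>\<omega>. u \<omega> \<bullet> v \<omega>)"
proof -
  note [measurable] = assms[THEN square_integrable_measurable]
  have "integrable M (\<lambda>\<omega>. (norm (u \<omega>))\<^sup>2 + (norm (v \<omega>))\<^sup>2)"
    using assms[THEN square_integrable_norm] by simp
  then show ?thesis
  proof (rule Bochner_Integration.integrable_bound)
    have "\<bar>u \<omega> \<bullet> v \<omega>\<bar> \<le> (norm (u \<omega>))\<^sup>2 + (norm (v \<omega>))\<^sup>2" for \<omega>
    proof -
      have "2 * (norm (u \<omega>) * norm (v \<omega>)) \<le> (norm (u \<omega>))\<^sup>2 + (norm (v \<omega>))\<^sup>2"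
        using sum_squares_bound[of "norm (u \<omega>)" "norm (v \<omega>)"] by simp
      moreover have "0 \<le> norm (u \<omega>) * norm (v \<omega>)" by simp
      ultimately show ?thesis using Cauchy_Schwarz_ineq2[of "u \<omega>" "v \<omega>"] by linarith
    qed
    then show "AE \<omega> in M. norm (u \<omega> \<bullet> v \<omega>) \<le> norm ((norm (u \<omega>))\<^sup>2 + (norm (v \<omega>))\<^sup>2)"
      by simp
  qed measurable
qed

text \<open>Stands in for conditioning on \<open>Y\<close>: independence makes the joint law a
  product, Fubini integrates over \<open>W\<close> first, and with \<open>y\<close> frozen this
  inner integral vanishes.\<close>

lemma indep_centred_expectation_zero:
  assumes indep: "indep_var N Y N' W"
    and h: "h \<in> borel_measurable (N \<Otimes>\<^sub>M N')"
    and centred: "\<And>y. y \<in> space N \<Longrightarrow> (\<integral>\<omega>. h (y, W \<omega>) \<partial>M) = (0::real)"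
    and int: "integrable M (\<lambda>\<omega>. h (Y \<omega>, W \<omega>))"
  shows "(\<integral>\<omega>. h (Y \<omega>, W \<omega>) \<partial>M) = 0"
proof -
  have [measurable]: "Y \<in> M \<rightarrow>\<^sub>M N" "W \<in> M \<rightarrow>\<^sub>M N'"
    using indep by (blast dest: indep_var_rv1 indep_var_rv2)+
  interpret Y: prob_space "distr M N Y" by (rule prob_space_distr) measurable
  interpret W: prob_space "distr M N' W" by (rule prob_space_distr) measurable
  interpret YW: pair_sigma_finite "distr M N Y" "distr M N' W" ..
  have joint: "distr M (N \<Otimes>\<^sub>M N') (\<lambda>\<omega>. (Y \<omega>, W \<omega>)) = distr M N Y \<Otimes>\<^sub>M distr M N' W"
    using indep by (simp add: indep_var_distribution_eq)
  have "integrable (distr M (N \<Otimes>\<^sub>M N') (\<lambda>\<omega>. (Y \<omega>, W \<omega>))) h"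
    using int h by (subst integrable_distr_eq) auto
  then have "integrable (distr M N Y \<Otimes>\<^sub>M distr M N' W) h" by (simp add: joint)
  then have "(\<integral>y. (\<integral>w. h (y, w) \<partial>distr M N' W) \<partial>distr M N Y)
      = integral\<^sup>L (distr M N Y \<Otimes>\<^sub>M distr M N' W) h"
    by (rule YW.integral_fst')
  moreover have "(\<integral>w. h (y, w) \<partial>distr M N' W) = 0" if y: "y \<in> space N" for y
  proof -
    have "(\<lambda>w. h (y, w)) \<in> borel_measurable N'"
      using h y by (intro measurable_compose[OF measurable_Pair1' h])
    then show ?thesis using centred[OF y] by (subst integral_distr) auto
  qed
  then have "(\<integral>y. (\<integral>w. h (y, w) \<partial>distr M N' W) \<partial>distr M N Y) = (\<integral>y. 0 \<partial>distr M N Y)"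
    by (intro Bochner_Integration.integral_cong) auto
  moreover have "(\<integral>\<omega>. h (Y \<omega>, W \<omega>) \<partial>M)
      = integral\<^sup>L (distr M (N \<Otimes>\<^sub>M N') (\<lambda>\<omega>. (Y \<omega>, W \<omega>))) h"
    using h by (subst integral_distr) auto
  ultimately show ?thesis by (simp add: joint)
qed

definition second_moment :: "('a \<Rightarrow> 'v::euclidean_space) \<Rightarrow> real" where
  "second_moment u = expectation (\<lambda>\<omega>. (norm (u \<omega>))\<^sup>2)"

lemma second_moment_nonneg: "0 \<le> second_moment u"
  by (simp add: second_moment_def)

lemma second_moment_mono:
  assumes "square_integrable u" "square_integrable v" "\<And>\<omega>. (norm (u \<omega>))\<^sup>2 \<le> c * (norm (v \<omega>))\<^sup>2"
  shows "second_moment u \<le> c * second_moment v"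
proof -
  have "expectation (\<lambda>\<omega>. (norm (u \<omega>))\<^sup>2) \<le> expectation (\<lambda>\<omega>. c * (norm (v \<omega>))\<^sup>2)"
    using assms by (intro integral_mono) (auto intro: square_integrable_norm)
  then show ?thesis by (simp add: second_moment_def)
qed

lemma second_moment_le_weighted:
  assumes u: "square_integrable u" and v: "square_integrable v" and w: "square_integrable w"
    and le: "\<And>\<omega>. (norm (u \<omega>))\<^sup>2 \<le> a * (norm (v \<omega>))\<^sup>2 + b * (norm (w \<omega>))\<^sup>2"
  shows "second_moment u \<le> a * second_moment v + b * second_moment w"
proof -
  have "expectation (\<lambda>\<omega>. (norm (u \<omega>))\<^sup>2)
      \<le> expectation (\<lambda>\<omega>. a * (norm (v \<omega>))\<^sup>2 + b * (norm (w \<omega>))\<^sup>2)"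
    using assms by (intro integral_mono) (auto intro!: square_integrable_norm)
  also have "\<dots> = a * second_moment v + b * second_moment w"
    using v w by (simp add: second_moment_def square_integrable_norm)
  finally show ?thesis by (simp add: second_moment_def)
qed

lemma second_moment_add:
  assumes "square_integrable u" "square_integrable v"
  shows "second_moment (\<lambda>\<omega>. u \<omega> + v \<omega>)
    = second_moment u + 2 * expectation (\<lambda>\<omega>. u \<omega> \<bullet> v \<omega>) + second_moment v"
proof -
  have "(\<lambda>\<omega>. (norm (u \<omega> + v \<omega>))\<^sup>2) = (\<lambda>\<omega>. (norm (u \<omega>))\<^sup>2 + 2 * (u \<omega> \<bullet> v \<omega>) + (norm (v \<omega>))\<^sup>2)"
    by (simp add: power2_norm_eq_inner algebra_simps inner_commute)
  then show ?thesis
    using assms by (simp add: second_moment_def square_integrable_norm square_integrable_inner)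
qed

text \<open>The bound is the fixed point of \<open>x = s * x + a / (1 - s)\<close>. It serves three
  times: for the momentum with rate \<mu>, and for the worker and server deltas with rate
  \<open>sqrt (1 - \<delta>)\<close>.\<close>

lemma second_moment_contraction:
  fixes u v w :: "'a \<Rightarrow> 'v::euclidean_space"
  assumes u: "square_integrable u" and v: "square_integrable v" and w: "square_integrable w"
    and le: "\<And>\<omega>. norm (u \<omega>) \<le> s * norm (w \<omega>)" and s: "0 \<le> s" "s < 1"
    and w_le: "second_moment w \<le> a / (1 - s)\<^sup>2" and v_le: "second_moment v \<le> a"
  shows "second_moment (\<lambda>\<omega>. u \<omega> + v \<omega>) \<le> a / (1 - s)\<^sup>2"
proof -
  have "second_moment (\<lambda>\<omega>. u \<omega> + v \<omega>) \<le> s * second_moment w + (1 / (1 - s)) * second_moment v"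
    by (intro second_moment_le_weighted square_integrable_add u v w
        order_trans[OF norm_contraction_add_sq[OF le s]]) simp
  also have "\<dots> \<le> s * (a / (1 - s)\<^sup>2) + (1 / (1 - s)) * a"
    using w_le v_le s by (intro add_mono mult_left_mono) auto
  also have "(1 / (1 - s)) * a = (1 - s) * (a / (1 - s)\<^sup>2)"
    using s by (simp add: power2_eq_square)
  also have "s * (a / (1 - s)\<^sup>2) + (1 - s) * (a / (1 - s)\<^sup>2) = a / (1 - s)\<^sup>2"
    unfolding distrib_right[symmetric] by simp
  finally show ?thesis .
qed

end

subsection \<open>Independence of the gradient noise from the past\<close>

text \<open>The new momentum stays a field of the next state instead of being unfolded, which
  matches the shape of \<open>delta\<close> and \<open>sdelta\<close> below.\<close>

lemma saef_sgd_sel_Suc: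
  assumes S: "S = saef_sgd Q \<mu> K lr g x0"
  shows "worker_mom (S (Suc t)) k = \<mu> *\<^sub>R worker_mom (S t) k + g t k (half_model (S t) k)"
    and "worker_err (S (Suc t)) k =
      (worker_err (S t) k + lr t *\<^sub>R worker_mom (S (Suc t)) k)
        - Q (worker_err (S t) k + lr t *\<^sub>R worker_mom (S (Suc t)) k)"
    and "server_err (S (Suc t)) =
      (server_err (S t) + (1 / real K) *\<^sub>R (\<Sum>k = 1..K. Q (worker_err (S t) k + lr t *\<^sub>R worker_mom (S (Suc t)) k)))
      - Q (server_err (S t) + (1 / real K) *\<^sub>R (\<Sum>k = 1..K. Q (worker_err (S t) k + lr t *\<^sub>R worker_mom (S (Suc t)) k)))"
    and "model (S (Suc t)) = model (S t)
      - Q (server_err (S t) + (1 / real K) *\<^sub>R (\<Sum>k = 1..K. Q (worker_err (S t) k + lr t *\<^sub>R worker_mom (S (Suc t)) k)))"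
  by (simp_all add: S saef_step_def Let_def)

text \<open>The setting of one run over an arbitrary Euclidean space. Joint measurability of
  \<open>grad_f\<close> is assumed here and discharged by \<open>gradient_borel_measurable\<close>
  at the interpretation.\<close>

locale saef_sampling = prob_space P for P :: "'w measure" +
  fixes D :: "'z measure"
    and grad_f :: "'v::euclidean_space \<Rightarrow> 'z \<Rightarrow> 'v"
    and F :: "'v \<Rightarrow> real" and grad_F :: "'v \<Rightarrow> 'v"
    and \<xi> :: "nat \<Rightarrow> nat \<Rightarrow> 'w \<Rightarrow> 'z"
    and Q :: "'v \<Rightarrow> 'v"
    and x0 xstar :: 'v
    and K T :: nat
    and \<mu> L \<sigma> M \<delta> \<eta> :: real
    and lr :: "nat \<Rightarrow> real"
    and S :: "nat \<Rightarrow> 'w \<Rightarrow> 'v saef_state"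
  assumes K: "1 \<le> K"
    and grad_f_measurable: "(\<lambda>p. grad_f (fst p) (snd p)) \<in> borel_measurable (borel \<Otimes>\<^sub>M D)"
    and grad_F: "\<And>x. GDERIV F x :> grad_F x"
    and unbiased: "\<And>x. integrable D (grad_f x)" "\<And>x. (\<integral>z. grad_f x z \<partial>D) = grad_F x"
    and minimizer: "\<And>x. F xstar \<le> F x"
    and indep: "indep_vars (\<lambda>_. D) (\<lambda>(k, t). \<xi> k t) ({1..K} \<times> {..<T})"
    and law: "\<And>k t. k \<in> {1..K} \<Longrightarrow> t < T \<Longrightarrow> distr P D (\<xi> k t) = D"
    and Q_measurable: "Q \<in> borel_measurable borel"
    and \<mu>: "0 \<le> \<mu>" "\<mu> < 1"
    and \<eta>: "0 < \<eta>" and lr: "\<And>t. t < T \<Longrightarrow> lr t = \<eta>"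
    and S: "\<And>t \<omega>. S t \<omega> = saef_sgd Q \<mu> K lr (\<lambda>t k x. grad_f x (\<xi> k t \<omega>)) x0 t"
    and lipschitz: "\<And>x y. norm (grad_F x - grad_F y) \<le> L * norm (x - y)"
    and variance_half:
      "\<And>k t. k \<in> {1..K} \<Longrightarrow> t < T \<Longrightarrow>
         integrable P (\<lambda>\<omega>. (norm (grad_f (half_model (S t \<omega>) k) (\<xi> k t \<omega>)
                               - grad_F (half_model (S t \<omega>) k)))\<^sup>2)"
      "\<And>k t. k \<in> {1..K} \<Longrightarrow> t < T \<Longrightarrow>
         (\<integral>\<omega>. (norm (grad_f (half_model (S t \<omega>) k) (\<xi> k t \<omega>)
                   - grad_F (half_model (S t \<omega>) k)))\<^sup>2 \<partial>P) \<le> \<sigma>\<^sup>2"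
    and grad_bound_half:
      "\<And>k t. k \<in> {1..K} \<Longrightarrow> t < T \<Longrightarrow>
         AE \<omega> in P. (norm (grad_F (half_model (S t \<omega>) k)))\<^sup>2 \<le> M\<^sup>2"
    and \<delta>: "0 < \<delta>" "\<delta> \<le> 1"
    and compressor: "\<And>v. (norm (Q v - v))\<^sup>2 \<le> (1 - \<delta>) * (norm v)\<^sup>2"
begin

section \<open>A run as a family of random vectors, and their recursions\<close>

definition mom :: "nat \<Rightarrow> nat \<Rightarrow> 'w \<Rightarrow> 'v" where "mom t k \<omega> = worker_mom (S t \<omega>) k"
definition err :: "nat \<Rightarrow> nat \<Rightarrow> 'w \<Rightarrow> 'v" where "err t k \<omega> = worker_err (S t \<omega>) k"
definition serr :: "nat \<Rightarrow> 'w \<Rightarrow> 'v" where "serr t \<omega> = server_err (S t \<omega>)"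
definition mdl :: "nat \<Rightarrow> 'w \<Rightarrow> 'v" where "mdl t \<omega> = model (S t \<omega>)"
definition half :: "nat \<Rightarrow> nat \<Rightarrow> 'w \<Rightarrow> 'v" where "half t k \<omega> = mdl t \<omega> - err t k \<omega>"
definition grad :: "nat \<Rightarrow> nat \<Rightarrow> 'w \<Rightarrow> 'v" where "grad t k \<omega> = grad_F (half t k \<omega>)"
definition sgrad :: "nat \<Rightarrow> nat \<Rightarrow> 'w \<Rightarrow> 'v" where "sgrad t k \<omega> = grad_f (half t k \<omega>) (\<xi> k t \<omega>)"
definition noise :: "nat \<Rightarrow> nat \<Rightarrow> 'w \<Rightarrow> 'v" where "noise t k \<omega> = sgrad t k \<omega> - grad t k \<omega>"
text \<open>The index is shifted: \<open>delta t k\<close> and \<open>sdelta t\<close> are the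
  vectors compressed during round \<open>t\<close>, which the algorithm numbers t+1. The constant
  \<eta> stands for \<open>lr t\<close>, so the recursions require \<open>t < T\<close>.\<close>

definition delta :: "nat \<Rightarrow> nat \<Rightarrow> 'w \<Rightarrow> 'v" where "delta t k \<omega> = err t k \<omega> + \<eta> *\<^sub>R mom (Suc t) k \<omega>"
definition mean :: "(nat \<Rightarrow> 'w \<Rightarrow> 'v) \<Rightarrow> 'w \<Rightarrow> 'v" where
  "mean u \<omega> = (1 / real K) *\<^sub>R (\<Sum>k = 1..K. u k \<omega>)"
definition sdelta :: "nat \<Rightarrow> 'w \<Rightarrow> 'v" where
  "sdelta t \<omega> = serr t \<omega> + mean (\<lambda>k \<omega>. Q (delta t k \<omega>)) \<omega>"

lemma half_model_eq: "half_model (S t \<omega>) k = half t k \<omega>"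
  by (simp add: half_model_def worker_model_def half_def mdl_def err_def)

lemma aux_model_eq: "aux_model K (S t \<omega>) = mdl t \<omega> - (serr t \<omega> + mean (err t) \<omega>)"
  by (simp add: aux_model_def mdl_def serr_def mean_def err_def)

lemma init: "mom 0 k \<omega> = 0" "err 0 k \<omega> = 0" "serr 0 \<omega> = 0" "mdl 0 \<omega> = x0"
  by (simp_all add: mom_def err_def serr_def mdl_def S saef_init_def)

lemma mom_Suc: "mom (Suc t) k \<omega> = \<mu> *\<^sub>R mom t k \<omega> + sgrad t k \<omega>"
  by (simp only: mom_def sgrad_def half_model_eq[symmetric] S saef_sgd_sel_Suc[OF refl])

lemma err_Suc: "t < T \<Longrightarrow> err (Suc t) k \<omega> = delta t k \<omega> - Q (delta t k \<omega>)"
  unfolding delta_def mom_def err_def S by (subst saef_sgd_sel_Suc[OF refl]) (simp only: lr)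

lemma serr_Suc: "t < T \<Longrightarrow> serr (Suc t) \<omega> = sdelta t \<omega> - Q (sdelta t \<omega>)"
  unfolding sdelta_def mean_def delta_def mom_def err_def serr_def S
  by (subst saef_sgd_sel_Suc[OF refl]) (simp only: lr)

lemma mdl_Suc: "t < T \<Longrightarrow> mdl (Suc t) \<omega> = mdl t \<omega> - Q (sdelta t \<omega>)"
  unfolding sdelta_def mean_def delta_def mom_def err_def serr_def mdl_def S
  by (subst saef_sgd_sel_Suc[OF refl]) (simp only: lr)

lemma xi_measurable [measurable]: "k \<in> {1..K} \<Longrightarrow> t < T \<Longrightarrow> \<xi> k t \<in> P \<rightarrow>\<^sub>M D"
  using indep by (auto simp: indep_vars_def)

text \<open>Comparing a unit basis vector with 0 bounds a norm by \<open>L\<close>.\<close>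

lemma L_nonneg: "0 \<le> L"
proof -
  obtain b :: 'v where "b \<in> Basis" using nonempty_Basis by blast
  then show ?thesis using order_trans[OF norm_ge_zero lipschitz[of b 0]] by simp
qed

lemma grad_F_continuous: "continuous_on UNIV grad_F"
  using lipschitz L_nonneg
  by (intro lipschitz_on_continuous_on lipschitz_onI) (auto simp: dist_norm)

lemma grad_F_measurable [measurable]: "grad_F \<in> borel_measurable borel"
  by (rule borel_measurable_continuous_onI) (rule grad_F_continuous)

text \<open>Pairs in \<open>A\<close> are (worker, time), so the past of time \<open>t\<close> is \<open>{1..K} \<times> {..<t}\<close>.\<close>

definition adapted :: "(nat \<times> nat) set \<Rightarrow> ('w \<Rightarrow> 'v) \<Rightarrow> bool" where
  "adapted A U \<longleftrightarrow> (\<exists>u \<in> borel_measurable (PiM A (\<lambda>_. D)).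
     \<forall>\<omega>. U \<omega> = u (\<lambda>i\<in>A. \<xi> (fst i) (snd i) \<omega>))"

lemma adaptedE:
  assumes "adapted A U"
  obtains u where "u \<in> borel_measurable (PiM A (\<lambda>_. D))"
    "\<forall>\<omega>. U \<omega> = u (\<lambda>i\<in>A. \<xi> (fst i) (snd i) \<omega>)"
  using assms unfolding adapted_def by blast

lemma adapted_const: "adapted A (\<lambda>\<omega>. c)"
  unfolding adapted_def by (intro bexI[of _ "\<lambda>_. c"]) auto

lemma adapted_compose:
  assumes h: "h \<in> borel_measurable borel" and "adapted A U"
  shows "adapted A (\<lambda>\<omega>. h (U \<omega>))"
proof -
  obtain u where "u \<in> borel_measurable (PiM A (\<lambda>_. D))" "\<forall>\<omega>. U \<omega> = u (\<lambda>i\<in>A. \<xi> (fst i) (snd i) \<omega>)"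
    using assms(2) by (rule adaptedE)
  then show ?thesis
    unfolding adapted_def using h by (intro bexI[of _ "\<lambda>x. h (u x)"]) auto
qed

lemma adapted_scaleR: "adapted A U \<Longrightarrow> adapted A (\<lambda>\<omega>. c *\<^sub>R U \<omega>)"
  by (rule adapted_compose) measurable

lemma adapted_add:
  assumes "adapted A U" "adapted A V"
  shows "adapted A (\<lambda>\<omega>. U \<omega> + V \<omega>)"
proof -
  obtain u where "u \<in> borel_measurable (PiM A (\<lambda>_. D))" "\<forall>\<omega>. U \<omega> = u (\<lambda>i\<in>A. \<xi> (fst i) (snd i) \<omega>)"
    using assms(1) by (rule adaptedE)
  moreover obtain v where "v \<in> borel_measurable (PiM A (\<lambda>_. D))" "\<forall>\<omega>. V \<omega> = v (\<lambda>i\<in>A. \<xi> (fst i) (snd i) \<omega>)"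
    using assms(2) by (rule adaptedE)
  ultimately show ?thesis
    unfolding adapted_def by (intro bexI[of _ "\<lambda>x. u x + v x"]) auto
qed

lemma adapted_diff: "adapted A U \<Longrightarrow> adapted A V \<Longrightarrow> adapted A (\<lambda>\<omega>. U \<omega> - V \<omega>)"
  using adapted_add[of A U "\<lambda>\<omega>. (-1) *\<^sub>R V \<omega>"] adapted_scaleR[of A V "-1"] by simp

lemma adapted_sum: "(\<And>i. i \<in> J \<Longrightarrow> adapted A (U i)) \<Longrightarrow> adapted A (\<lambda>\<omega>. \<Sum>i\<in>J. U i \<omega>)"
  by (induction J rule: infinite_finite_induct) (auto intro: adapted_const adapted_add)

lemma adapted_mean: "(\<And>k. k \<in> {1..K} \<Longrightarrow> adapted A (U k)) \<Longrightarrow> adapted A (mean U)"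
  unfolding mean_def by (intro adapted_scaleR adapted_sum)

text \<open>Here joint measurability enters: the random point and the sample are functions of the
  same family, so \<open>grad_f\<close> is composed with a map into the product space.\<close>

lemma adapted_sample:
  assumes "adapted A U" "(k, t) \<in> A"
  shows "adapted A (\<lambda>\<omega>. grad_f (U \<omega>) (\<xi> k t \<omega>))"
proof -
  obtain u where u: "u \<in> borel_measurable (PiM A (\<lambda>_. D))" "\<forall>\<omega>. U \<omega> = u (\<lambda>i\<in>A. \<xi> (fst i) (snd i) \<omega>)"
    using assms(1) by (rule adaptedE)
  have "(\<lambda>x. (u x, x (k, t))) \<in> PiM A (\<lambda>_. D) \<rightarrow>\<^sub>M borel \<Otimes>\<^sub>M D"
    using u(1) assms(2) by measurable
  from measurable_compose[OF this grad_f_measurable]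
  have "(\<lambda>x. grad_f (u x) (x (k, t))) \<in> borel_measurable (PiM A (\<lambda>_. D))" by simp
  then show ?thesis
    unfolding adapted_def using u(2) assms(2)
    by (intro bexI[of _ "\<lambda>x. grad_f (u x) (x (k, t))"]) auto
qed

lemma adapted_measurable:
  assumes "adapted A U" "A \<subseteq> {1..K} \<times> {..<T}"
  shows "U \<in> borel_measurable P"
proof -
  obtain u where u: "u \<in> borel_measurable (PiM A (\<lambda>_. D))" "\<forall>\<omega>. U \<omega> = u (\<lambda>i\<in>A. \<xi> (fst i) (snd i) \<omega>)"
    using assms(1) by (rule adaptedE)
  have "(\<lambda>\<omega>. \<lambda>i\<in>A. \<xi> (fst i) (snd i) \<omega>) \<in> P \<rightarrow>\<^sub>M PiM A (\<lambda>_. D)"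
    using assms(2) by (intro measurable_restrict xi_measurable) auto
  from measurable_compose[OF this u(1)] show ?thesis by (simp add: u(2)[THEN spec, symmetric])
qed

text \<open>One induction for all components, because each update reads the others. \<open>A\<close>
  may be any superset of the past, so that it can later be enlarged by a sample of the current
  round.\<close>

lemma adapted_state:
  assumes "{1..K} \<times> {..<t} \<subseteq> A" "t \<le> T"
  shows "adapted A (mdl t) \<and> adapted A (serr t) \<and> (\<forall>k\<in>{1..K}. adapted A (err t k) \<and> adapted A (mom t k))"
  using assms
proof (induction t)
  case 0
  then show ?case by (simp add: init[abs_def] adapted_const)
next
  case (Suc t)
  then have "t < T" and sub: "{1..K} \<times> {..<t} \<subseteq> A" by force+
  then have IH: "adapted A (mdl t)" "adapted A (serr t)"
    "\<And>k. k \<in> {1..K} \<Longrightarrow> adapted A (err t k)" "\<And>k. k \<in> {1..K} \<Longrightarrow> adapted A (mom t k)"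
    using Suc.IH by auto
  have mom: "adapted A (mom (Suc t) k)" if k: "k \<in> {1..K}" for k
  proof -
    have "(k, t) \<in> A" using Suc.prems(1) k by auto
    then show ?thesis
      unfolding mom_Suc[abs_def] sgrad_def half_def using k
      by (intro adapted_add adapted_scaleR adapted_sample adapted_diff IH)
  qed
  have delta: "adapted A (delta t k)" if "k \<in> {1..K}" for k
    unfolding delta_def using that by (intro adapted_add adapted_scaleR IH mom)
  have sdelta: "adapted A (sdelta t)"
    unfolding sdelta_def
    by (intro adapted_add IH adapted_mean adapted_compose[OF Q_measurable] delta)
  show ?case
    unfolding mdl_Suc[OF \<open>t < T\<close>, abs_def] serr_Suc[OF \<open>t < T\<close>, abs_def] err_Suc[OF \<open>t < T\<close>, abs_def]
    by (intro conjI ballI adapted_diff IH sdelta adapted_compose[OF Q_measurable] delta mom)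
qed

lemma
  assumes "t \<le> T" "{1..K} \<times> {..<t} \<subseteq> A"
  shows adapted_mdl: "adapted A (mdl t)"
    and adapted_serr: "adapted A (serr t)"
    and adapted_err: "k \<in> {1..K} \<Longrightarrow> adapted A (err t k)"
    and adapted_mom: "k \<in> {1..K} \<Longrightarrow> adapted A (mom t k)"
  using adapted_state[OF assms(2,1)] by simp_all

lemma adapted_half: "t \<le> T \<Longrightarrow> {1..K} \<times> {..<t} \<subseteq> A \<Longrightarrow> k \<in> {1..K} \<Longrightarrow> adapted A (half t k)"
  unfolding half_def by (intro adapted_diff adapted_mdl adapted_err)

lemma adapted_grad: "t \<le> T \<Longrightarrow> {1..K} \<times> {..<t} \<subseteq> A \<Longrightarrow> k \<in> {1..K} \<Longrightarrow> adapted A (grad t k)"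
  unfolding grad_def by (intro adapted_compose[OF grad_F_measurable] adapted_half)

lemma adapted_noise:
  "t \<le> T \<Longrightarrow> {1..K} \<times> {..<t} \<subseteq> A \<Longrightarrow> (k, t) \<in> A \<Longrightarrow> k \<in> {1..K} \<Longrightarrow> adapted A (noise t k)"
  unfolding noise_def sgrad_def by (intro adapted_diff adapted_sample adapted_half adapted_grad)

lemma noise_square_integrable:
  assumes "k \<in> {1..K}" "t < T"
  shows "square_integrable (noise t k)"
proof -
  have "noise t k \<in> borel_measurable P"
    by (rule adapted_measurable[OF adapted_noise[of t "{1..K} \<times> {..<Suc t}"]]) (use assms in auto)
  then show ?thesis
    using variance_half(1)[OF assms]
    by (simp add: square_integrable_def half_model_eq noise_def sgrad_def grad_def)
qed

lemma noise_variance: "k \<in> {1..K} \<Longrightarrow> t < T \<Longrightarrow> expectation (\<lambda>\<omega>. (norm (noise t k \<omega>))\<^sup>2) \<le> \<sigma>\<^sup>2"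
  using variance_half(2) by (simp add: half_model_eq noise_def sgrad_def grad_def)

text \<open>\<open>U\<close> and the step-ahead point are functions of the samples in
  \<open>A\<close>, which are independent of the sample \<open>(k, t)\<close> outside
  \<open>A\<close>. With the former frozen, unbiasedness centres the noise.\<close>

lemma noise_orthogonal:
  assumes k: "k \<in> {1..K}" and t: "t < T"
    and A: "{1..K} \<times> {..<t} \<subseteq> A" "A \<subseteq> {1..K} \<times> {..<T}" "(k, t) \<notin> A"
    and U: "adapted A U" "square_integrable U"
  shows "expectation (\<lambda>\<omega>. U \<omega> \<bullet> noise t k \<omega>) = 0"
proof -
  define Y where "Y = (\<lambda>\<omega>. \<lambda>i\<in>A. \<xi> (fst i) (snd i) \<omega>)"
  define N where "N = PiM A (\<lambda>_. D)"
  obtain u where u: "u \<in> borel_measurable N" and Uu: "\<forall>\<omega>. U \<omega> = u (Y \<omega>)"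
    unfolding N_def Y_def using U(1) by (rule adaptedE)
  have "adapted A (half t k)"
    using A(1) k t by (intro adapted_half) auto
  then obtain x where x: "x \<in> borel_measurable N" and hx: "\<forall>\<omega>. half t k \<omega> = x (Y \<omega>)"
    unfolding N_def Y_def by (rule adaptedE)
  note [measurable] = u x
  \<comment> \<open>\<open>indep_var_restrict\<close> speaks of families, so the single sample is
    carried as a family over a one-element index set.\<close>
  define W where "W = (\<lambda>\<omega>. \<lambda>i\<in>{(k, t)}. \<xi> (fst i) (snd i) \<omega>)"
  define N' where "N' = PiM {(k, t)} (\<lambda>_. D)"
  define h where
    "h p = u (fst p) \<bullet> (grad_f (x (fst p)) (snd p (k, t)) - grad_F (x (fst p)))" for p
  have eq: "U \<omega> \<bullet> noise t k \<omega> = h (Y \<omega>, W \<omega>)" for \<omega>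
    by (simp add: h_def W_def Uu hx noise_def sgrad_def grad_def)
  have ind: "indep_var N Y N' W"
    using indep_var_restrict[OF indep, of A "{(k, t)}"] A k t
    by (simp add: case_prod_beta N_def Y_def N'_def W_def)
  have D: "prob_space D" using prob_space_distr[OF xi_measurable[OF k t]] law[OF k t] by simp
  interpret D: prob_space D by (rule D)
  have "(\<integral>\<omega>. h (Y \<omega>, W \<omega>) \<partial>P) = 0"
  proof (rule indep_centred_expectation_zero[OF ind])
    have "(\<lambda>p. snd p (k, t)) \<in> N \<Otimes>\<^sub>M N' \<rightarrow>\<^sub>M D"
      unfolding N'_def
      by (rule measurable_compose[OF measurable_snd measurable_component_singleton]) simp
    then have "(\<lambda>p. (x (fst p), snd p (k, t))) \<in> N \<Otimes>\<^sub>M N' \<rightarrow>\<^sub>M borel \<Otimes>\<^sub>M D" by measurable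
    from measurable_compose[OF this grad_f_measurable]
    have "(\<lambda>p. grad_f (x (fst p)) (snd p (k, t))) \<in> borel_measurable (N \<Otimes>\<^sub>M N')" by simp
    then show "h \<in> borel_measurable (N \<Otimes>\<^sub>M N')" unfolding h_def by measurable
    show "(\<integral>\<omega>. h (y, W \<omega>) \<partial>P) = 0" for y
    proof -
      have "(\<lambda>z. grad_f (x y) z) \<in> borel_measurable D"
        using unbiased(1) by (rule borel_measurable_integrable)
      then have "(\<integral>\<omega>. h (y, W \<omega>) \<partial>P)
          = (\<integral>z. u y \<bullet> (grad_f (x y) z - grad_F (x y)) \<partial>distr P D (\<xi> k t))"
        using k t by (subst integral_distr) (auto simp: h_def W_def)
      also have "\<dots> = 0"
        using unbiased[of "x y"] by (simp add: law[OF k t] D.prob_space)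
      finally show ?thesis .
    qed
    show "integrable P (\<lambda>\<omega>. h (Y \<omega>, W \<omega>))"
      unfolding eq[symmetric] using U(2) noise_square_integrable[OF k t] by (rule square_integrable_inner)
  qed
  then show ?thesis by (simp add: eq)
qed

lemma lipschitz_sq: "(norm (grad_F x - grad_F y))\<^sup>2 \<le> L\<^sup>2 * (norm (x - y))\<^sup>2"
  using power_mono[OF lipschitz norm_ge_zero, of x y 2] by (simp add: power_mult_distrib)

text \<open>Used twice: with \<open>y = 0\<close> as a growth bound, and to pass from the gradients
  at step-ahead points to those at \<open>mdl\<close> and \<open>aux\<close>.\<close>

lemma grad_sq_le: "(norm (grad_F x))\<^sup>2 \<le> 2 * (norm (grad_F y))\<^sup>2 + 2 * L\<^sup>2 * (norm (x - y))\<^sup>2"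
  using norm_add_sq_le_weighted[of 1 "grad_F y" "grad_F x - grad_F y"] lipschitz_sq[of x y] by simp

subsection \<open>Second moments of momentum and compression errors\<close>

text \<open>Contraction factor of the compression residual in norm, needed by the error recursions;
  a single residual is estimated by the factor \<open>1 - \<delta>\<close> for squares.\<close>

abbreviation s :: real where "s \<equiv> sqrt (1 - \<delta>)"

lemma s: "0 \<le> s" "s < 1" "s\<^sup>2 = 1 - \<delta>"
  using \<delta> by auto

lemma compress: "norm (v - Q v) \<le> s * norm v"
proof (rule power2_le_imp_le)
  show "(norm (v - Q v))\<^sup>2 \<le> (s * norm v)\<^sup>2"
    using compressor[of v] by (simp add: power_mult_distrib s norm_minus_commute)
qed (use s in simp)

text \<open>Splitting \<open>Q v\<close> into the residual and \<open>v\<close> gives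
  2(1-\<delta>)+2, the origin of the factor 2-\<delta> in \<open>C\<close>.\<close>

lemma norm_Q_sq: "(norm (Q v))\<^sup>2 \<le> 2 * (2 - \<delta>) * (norm v)\<^sup>2"
  using norm_add_sq_le_weighted[of 1 "Q v - v" v] compressor[of v] by (simp add: algebra_simps)

lemma mean_sq_le: "(norm (mean u \<omega>))\<^sup>2 \<le> (\<Sum>k = 1..K. (norm (u k \<omega>))\<^sup>2) / K"
proof -
  have "0 \<le> (\<Sum>k = 1..K. (norm (mean u \<omega> - u k \<omega>))\<^sup>2) / K" by (simp add: sum_nonneg)
  then show ?thesis
    using norm_sq_mean_add_deviation[OF K mean_def[of u \<omega>]] by linarith
qed

lemma mean_add: "mean (\<lambda>k \<omega>. u k \<omega> + v k \<omega>) \<omega> = mean u \<omega> + mean v \<omega>"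
  by (simp add: mean_def sum.distrib scaleR_add_right)

lemma mean_diff: "mean (\<lambda>k \<omega>. u k \<omega> - v k \<omega>) \<omega> = mean u \<omega> - mean v \<omega>"
  by (simp add: mean_def sum_subtractf scaleR_diff_right)

lemma mean_scaleR: "mean (\<lambda>k \<omega>. c *\<^sub>R u k \<omega>) \<omega> = c *\<^sub>R mean u \<omega>"
  by (simp add: mean_def scaleR_sum_right[symmetric] mult.commute)

lemma average_ge:
  fixes a :: real
  assumes "\<And>k. k \<in> {1..K} \<Longrightarrow> a \<le> u k"
  shows "a \<le> (\<Sum>k = 1..K. u k) / K"
  using sum_bounded_below[of "{1..K}" a u] assms K by (simp add: field_simps)

lemma average_le:
  fixes a :: real
  assumes "\<And>k. k \<in> {1..K} \<Longrightarrow> u k \<le> a"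
  shows "(\<Sum>k = 1..K. u k) / K \<le> a"
  using sum_bounded_above[of "{1..K}" u a] assms K by (simp add: field_simps)

lemma square_integrable_mean:
  "(\<And>k. k \<in> {1..K} \<Longrightarrow> square_integrable (u k)) \<Longrightarrow> square_integrable (mean u)"
  unfolding mean_def by (intro square_integrable_scaleR square_integrable_sum)

lemma second_moment_mean_le:
  assumes "\<And>k. k \<in> {1..K} \<Longrightarrow> square_integrable (u k)"
  shows "second_moment (mean u) \<le> (\<Sum>k = 1..K. second_moment (u k)) / K"
proof -
  have "expectation (\<lambda>\<omega>. (norm (mean u \<omega>))\<^sup>2)
      \<le> expectation (\<lambda>\<omega>. (\<Sum>k = 1..K. (norm (u k \<omega>))\<^sup>2) / K)"
    by (intro integral_mono mean_sq_le Bochner_Integration.integrable_divide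
        Bochner_Integration.integrable_sum square_integrable_norm square_integrable_mean assms)
  also have "\<dots> = (\<Sum>k = 1..K. second_moment (u k)) / K"
    using assms by (simp add: second_moment_def square_integrable_norm)
  finally show ?thesis by (simp add: second_moment_def)
qed

lemma square_integrable_grad_F:
  assumes "square_integrable u"
  shows "square_integrable (\<lambda>\<omega>. grad_F (u \<omega>))"
proof (rule square_integrable_dominated[OF _ assms])
  show "(\<lambda>\<omega>. grad_F (u \<omega>)) \<in> borel_measurable P"
    using square_integrable_measurable[OF assms] by measurable
  show "(norm (grad_F (u \<omega>)))\<^sup>2 \<le> 2 * (norm (grad_F 0))\<^sup>2 + 2 * L\<^sup>2 * (norm (u \<omega>))\<^sup>2" for \<omega>
    using grad_sq_le[of "u \<omega>" 0] by simp
qed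

lemma square_integrable_Q:
  assumes "square_integrable u"
  shows "square_integrable (\<lambda>\<omega>. Q (u \<omega>))"
proof (rule square_integrable_dominated[OF _ assms])
  show "(\<lambda>\<omega>. Q (u \<omega>)) \<in> borel_measurable P"
    using square_integrable_measurable[OF assms] Q_measurable by measurable
  show "(norm (Q (u \<omega>)))\<^sup>2 \<le> 0 + 2 * (2 - \<delta>) * (norm (u \<omega>))\<^sup>2" for \<omega>
    using norm_Q_sq by simp
qed

section \<open>Square integrability along the run\<close>

lemma square_integrable_state:
  "t \<le> T \<Longrightarrow> square_integrable (mdl t) \<and> square_integrable (serr t) \<and>
    (\<forall>k\<in>{1..K}. square_integrable (err t k) \<and> square_integrable (mom t k))"
proof (induction t)
  case 0
  then show ?case by (simp add: init[abs_def] square_integrable_const)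
next
  case (Suc t)
  then have t: "t < T" by simp
  then have IH: "square_integrable (mdl t)" "square_integrable (serr t)"
    "\<And>k. k \<in> {1..K} \<Longrightarrow> square_integrable (err t k)" "\<And>k. k \<in> {1..K} \<Longrightarrow> square_integrable (mom t k)"
    using Suc.IH by auto
  \<comment> \<open>The gradient grows at most linearly in the state and the noise is square
    integrable by the variance assumption, so finiteness propagates from round to round.\<close>
  have sgrad: "square_integrable (sgrad t k)" if k: "k \<in> {1..K}" for k
  proof -
    have "square_integrable (grad t k)"
      unfolding grad_def half_def using k by (intro square_integrable_grad_F square_integrable_diff IH)
    from square_integrable_add[OF this noise_square_integrable[OF k t]]
    show ?thesis by (simp add: noise_def)
  qed
  have mom: "square_integrable (mom (Suc t) k)" if k: "k \<in> {1..K}" for k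
    unfolding mom_Suc[abs_def] using k
    by (intro square_integrable_add square_integrable_scaleR IH sgrad)
  have delta: "square_integrable (delta t k)" if "k \<in> {1..K}" for k
    unfolding delta_def using that by (intro square_integrable_add square_integrable_scaleR IH mom)
  have sdelta: "square_integrable (sdelta t)"
    unfolding sdelta_def
    by (intro square_integrable_add IH square_integrable_mean square_integrable_Q delta)
  show ?case
    unfolding mdl_Suc[OF t, abs_def] serr_Suc[OF t, abs_def] err_Suc[OF t, abs_def]
    by (intro conjI ballI square_integrable_diff IH sdelta square_integrable_Q delta mom)
qed

lemma
  assumes "t \<le> T"
  shows square_integrable_mdl: "square_integrable (mdl t)"
    and square_integrable_serr: "square_integrable (serr t)"
    and square_integrable_err: "k \<in> {1..K} \<Longrightarrow> square_integrable (err t k)"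
    and square_integrable_mom: "k \<in> {1..K} \<Longrightarrow> square_integrable (mom t k)"
  using square_integrable_state[OF assms] by simp_all

lemma square_integrable_grad:
  assumes "t \<le> T" "k \<in> {1..K}" shows "square_integrable (grad t k)"
  unfolding grad_def half_def using assms
  by (intro square_integrable_grad_F square_integrable_diff square_integrable_mdl square_integrable_err)

lemma sgrad_eq: "sgrad t k = (\<lambda>\<omega>. grad t k \<omega> + noise t k \<omega>)"
  by (simp add: noise_def)

lemma square_integrable_sgrad:
  assumes "t < T" "k \<in> {1..K}" shows "square_integrable (sgrad t k)"
  unfolding sgrad_eq using assms
  by (intro square_integrable_add square_integrable_grad noise_square_integrable) auto

lemma square_integrable_delta:
  assumes "t < T" "k \<in> {1..K}" shows "square_integrable (delta t k)"
  unfolding delta_def using assms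
  by (intro square_integrable_add square_integrable_scaleR square_integrable_err square_integrable_mom) auto

lemma square_integrable_sdelta:
  assumes "t < T" shows "square_integrable (sdelta t)"
  unfolding sdelta_def using assms
  by (intro square_integrable_add square_integrable_serr square_integrable_mean square_integrable_Q
      square_integrable_delta) auto

section \<open>Orthogonality and variance of the gradient noise\<close>

lemma past_noise_orthogonal:
  assumes t: "t < T" and k: "k \<in> {1..K}"
    and U: "adapted ({1..K} \<times> {..<t}) U" "square_integrable U"
  shows "expectation (\<lambda>\<omega>. U \<omega> \<bullet> noise t k \<omega>) = 0"
  using t by (intro noise_orthogonal[OF k t _ _ _ U]) auto

lemma mean_noise_orthogonal:
  assumes t: "t < T" and U: "adapted ({1..K} \<times> {..<t}) U" "square_integrable U"
  shows "expectation (\<lambda>\<omega>. U \<omega> \<bullet> mean (noise t) \<omega>) = 0"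
proof -
  have "expectation (\<lambda>\<omega>. U \<omega> \<bullet> mean (noise t) \<omega>)
      = (1 / real K) * (\<Sum>k = 1..K. expectation (\<lambda>\<omega>. U \<omega> \<bullet> noise t k \<omega>))"
    unfolding mean_def inner_scaleR_right inner_sum_right
    using t U(2) by (simp add: square_integrable_inner noise_square_integrable)
  then show ?thesis using past_noise_orthogonal[OF t _ U] by simp
qed

text \<open>The noise of worker \<open>j\<close> is adapted to the past enlarged by its own sample,
  and the sample of worker \<open>k\<close> still lies outside this set.\<close>

lemma noise_noise_orthogonal:
  assumes t: "t < T" and k: "k \<in> {1..K}" and j: "j \<in> {1..K}" "j \<noteq> k"
  shows "expectation (\<lambda>\<omega>. noise t j \<omega> \<bullet> noise t k \<omega>) = 0"
proof (rule noise_orthogonal[OF k t, of "insert (j, t) ({1..K} \<times> {..<t})"])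
  show "adapted (insert (j, t) ({1..K} \<times> {..<t})) (noise t j)"
    using t j by (intro adapted_noise) auto
qed (use t j in \<open>auto intro: noise_square_integrable\<close>)

text \<open>Of the K^2 inner products only the K diagonal ones survive, whence the gain of 1/K over
  a single noise vector.\<close>

lemma second_moment_noise_mean:
  assumes t: "t < T"
  shows "second_moment (mean (noise t)) \<le> \<sigma>\<^sup>2 / K"
proof -
  have noise: "square_integrable (noise t k)" if "k \<in> {1..K}" for k
    using that t by (rule noise_square_integrable)
  have "(norm (mean (noise t) \<omega>))\<^sup>2
      = (\<Sum>k = 1..K. \<Sum>j = 1..K. noise t j \<omega> \<bullet> noise t k \<omega>) / (real K)\<^sup>2" for \<omega>
    unfolding power2_norm_eq_inner mean_def inner_scaleR_left inner_scaleR_right inner_sum_left inner_sum_right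
    by (simp add: power2_eq_square inner_commute sum_divide_distrib[symmetric])
  then have "second_moment (mean (noise t))
      = expectation (\<lambda>\<omega>. \<Sum>k = 1..K. \<Sum>j = 1..K. noise t j \<omega> \<bullet> noise t k \<omega>) / (real K)\<^sup>2"
    by (simp add: second_moment_def)
  also have "expectation (\<lambda>\<omega>. \<Sum>k = 1..K. \<Sum>j = 1..K. noise t j \<omega> \<bullet> noise t k \<omega>)
      = (\<Sum>k = 1..K. expectation (\<lambda>\<omega>. \<Sum>j = 1..K. noise t j \<omega> \<bullet> noise t k \<omega>))"
    by (intro Bochner_Integration.integral_sum Bochner_Integration.integrable_sum
        square_integrable_inner noise)
  also have "\<dots> = (\<Sum>k = 1..K. \<Sum>j = 1..K. expectation (\<lambda>\<omega>. noise t j \<omega> \<bullet> noise t k \<omega>))"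
    by (intro sum.cong refl Bochner_Integration.integral_sum square_integrable_inner noise)
  also have "(\<Sum>k = 1..K. \<Sum>j = 1..K. expectation (\<lambda>\<omega>. noise t j \<omega> \<bullet> noise t k \<omega>))
      = (\<Sum>k = 1..K. \<Sum>j = 1..K. if j = k then second_moment (noise t k) else 0)"
    by (intro sum.cong refl)
      (simp add: noise_noise_orthogonal[OF t] second_moment_def power2_norm_eq_inner)
  also have "\<dots> = (\<Sum>k = 1..K. second_moment (noise t k))" by simp
  also have "\<dots> \<le> (\<Sum>k = 1..K. \<sigma>\<^sup>2)"
    using noise_variance[OF _ t] by (intro sum_mono) (simp add: second_moment_def)
  finally show ?thesis using K by (simp add: field_simps power2_eq_square divide_right_mono)
qed

lemma second_moment_sgrad:
  assumes t: "t < T" and k: "k \<in> {1..K}"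
  shows "second_moment (sgrad t k) \<le> M\<^sup>2 + \<sigma>\<^sup>2"
proof -
  have grad: "square_integrable (grad t k)" using t k by (intro square_integrable_grad) auto
  have "adapted ({1..K} \<times> {..<t}) (grad t k)" using t k by (intro adapted_grad) auto
  then have "second_moment (sgrad t k) = second_moment (grad t k) + second_moment (noise t k)"
    unfolding sgrad_eq second_moment_add[OF grad noise_square_integrable[OF k t]]
    using past_noise_orthogonal[OF t k _ grad] by simp
  moreover have "second_moment (grad t k) \<le> M\<^sup>2"
    unfolding second_moment_def
    using grad_bound_half[OF k t] square_integrable_norm[OF grad]
    by (intro integral_le_const) (auto simp: half_model_eq grad_def)
  moreover have "second_moment (noise t k) \<le> \<sigma>\<^sup>2"
    using noise_variance[OF k t] by (simp add: second_moment_def)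
  ultimately show ?thesis by linarith
qed

text \<open>Jensen's inequality is applied to the gradient part only; the noise part is split off by
  orthogonality and so retains its factor 1/K.\<close>

lemma second_moment_sgrad_mean:
  assumes t: "t < T"
  shows "second_moment (mean (sgrad t)) \<le> (\<Sum>k = 1..K. second_moment (grad t k)) / K + \<sigma>\<^sup>2 / K"
proof -
  have grad: "square_integrable (grad t k)" if "k \<in> {1..K}" for k
    using t that by (intro square_integrable_grad) auto
  have mg: "square_integrable (mean (grad t))" by (intro square_integrable_mean grad)
  have mn: "square_integrable (mean (noise t))"
    using t by (intro square_integrable_mean noise_square_integrable)
  have ad: "adapted ({1..K} \<times> {..<t}) (mean (grad t))" using t by (intro adapted_mean adapted_grad) auto
  have "mean (sgrad t) = (\<lambda>\<omega>. mean (grad t) \<omega> + mean (noise t) \<omega>)"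
    by (rule ext) (simp add: mean_add[symmetric] sgrad_eq[symmetric])
  then have "second_moment (mean (sgrad t)) = second_moment (mean (grad t)) + second_moment (mean (noise t))"
    using second_moment_add[OF mg mn] mean_noise_orthogonal[OF t ad mg] by simp
  then show ?thesis
    using second_moment_mean_le[of "grad t", OF grad] second_moment_noise_mean[OF t] by linarith
qed

section \<open>Uniform second-moment bounds for momentum, deltas and errors\<close>

definition G2 :: real where "G2 = M\<^sup>2 + \<sigma>\<^sup>2"
text \<open>The bound for a worker's \<open>delta\<close>: the contraction invariant applied twice,
  first to the momentum with rate \<mu> and input \<open>G2\<close>, then, after scaling by \<eta>,
  to the delta with rate \<open>s\<close>.\<close>

definition H2 :: real where "H2 = (\<eta>\<^sup>2 * (G2 / (1 - \<mu>)\<^sup>2)) / (1 - s)\<^sup>2"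

lemma G2_nonneg: "0 \<le> G2" by (simp add: G2_def)
lemma H2_nonneg: "0 \<le> H2" by (simp add: H2_def G2_nonneg)

lemma second_moment_zero: "second_moment (\<lambda>\<omega>. 0) = 0"
  by (simp add: second_moment_def)

lemma second_moment_mom:
  assumes "t \<le> T" "k \<in> {1..K}"
  shows "second_moment (mom t k) \<le> G2 / (1 - \<mu>)\<^sup>2"
  using assms
proof (induction t)
  case 0
  then show ?case by (simp add: init[abs_def] second_moment_zero G2_nonneg)
next
  case (Suc t)
  show ?case
    unfolding mom_Suc[abs_def]
  proof (rule second_moment_contraction)
    show "second_moment (mom t k) \<le> G2 / (1 - \<mu>)\<^sup>2" using Suc by simp
    show "second_moment (sgrad t k) \<le> G2" using Suc by (simp add: G2_def second_moment_sgrad)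
    show "norm (\<mu> *\<^sub>R mom t k \<omega>) \<le> \<mu> * norm (mom t k \<omega>)" for \<omega> using \<mu> by simp
  qed (use Suc.prems \<mu> in \<open>auto intro!: square_integrable_scaleR square_integrable_mom square_integrable_sgrad\<close>)
qed

lemma second_moment_scaled_mom:
  assumes "t \<le> T" "k \<in> {1..K}"
  shows "second_moment (\<lambda>\<omega>. \<eta> *\<^sub>R mom t k \<omega>) \<le> \<eta>\<^sup>2 * (G2 / (1 - \<mu>)\<^sup>2)"
  using mult_left_mono[OF second_moment_mom[OF assms], of "\<eta>\<^sup>2"]
  by (simp add: second_moment_def power_mult_distrib)

lemma second_moment_delta:
  assumes "t < T" "k \<in> {1..K}"
  shows "second_moment (delta t k) \<le> H2"
  using assms
proof (induction t)
  case 0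
  have "second_moment (\<lambda>\<omega>. err 0 k \<omega> + \<eta> *\<^sub>R mom (Suc 0) k \<omega>) \<le> (\<eta>\<^sup>2 * (G2 / (1 - \<mu>)\<^sup>2)) / (1 - s)\<^sup>2"
  proof (rule second_moment_contraction)
    \<comment> \<open>The initial error is not the residual of an earlier delta; the zero vector
      takes the place of that delta.\<close>
    show "second_moment (\<lambda>\<omega>. 0::'v) \<le> (\<eta>\<^sup>2 * (G2 / (1 - \<mu>)\<^sup>2)) / (1 - s)\<^sup>2"
      by (simp add: second_moment_zero G2_nonneg)
    show "second_moment (\<lambda>\<omega>. \<eta> *\<^sub>R mom (Suc 0) k \<omega>) \<le> \<eta>\<^sup>2 * (G2 / (1 - \<mu>)\<^sup>2)"
      using 0 by (intro second_moment_scaled_mom) auto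
  qed (use 0 s in \<open>auto simp: init[abs_def] intro!: square_integrable_const square_integrable_scaleR square_integrable_mom\<close>)
  then show ?case by (simp add: delta_def[abs_def] H2_def)
next
  case (Suc t)
  have "second_moment (\<lambda>\<omega>. err (Suc t) k \<omega> + \<eta> *\<^sub>R mom (Suc (Suc t)) k \<omega>) \<le> (\<eta>\<^sup>2 * (G2 / (1 - \<mu>)\<^sup>2)) / (1 - s)\<^sup>2"
  proof (rule second_moment_contraction)
    show "second_moment (delta t k) \<le> (\<eta>\<^sup>2 * (G2 / (1 - \<mu>)\<^sup>2)) / (1 - s)\<^sup>2"
      using Suc by (simp add: H2_def)
    show "second_moment (\<lambda>\<omega>. \<eta> *\<^sub>R mom (Suc (Suc t)) k \<omega>) \<le> \<eta>\<^sup>2 * (G2 / (1 - \<mu>)\<^sup>2)"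
      using Suc.prems by (intro second_moment_scaled_mom) auto
    show "norm (err (Suc t) k \<omega>) \<le> s * norm (delta t k \<omega>)" for \<omega>
      using Suc.prems by (simp add: err_Suc compress)
  qed (use Suc.prems s in \<open>auto intro!: square_integrable_err square_integrable_delta square_integrable_scaleR square_integrable_mom\<close>)
  then show ?case by (simp add: delta_def[abs_def] H2_def)
qed

text \<open>The residual of the preceding delta gains the factor 1-\<delta>, which reappears in the
  error terms of both claims.\<close>

lemma second_moment_err:
  assumes "t \<le> T" "k \<in> {1..K}"
  shows "second_moment (err t k) \<le> (1 - \<delta>) * H2"
proof (cases t)
  case 0
  then show ?thesis using \<delta> H2_nonneg by (simp add: init[abs_def] second_moment_zero)
next
  case (Suc t')
  then have t': "t' < T" using assms by simp
  have "second_moment (err t k) \<le> (1 - \<delta>) * second_moment (delta t' k)"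
    using compressor assms t'
    by (intro second_moment_mono square_integrable_err square_integrable_delta)
      (auto simp: Suc err_Suc norm_minus_commute)
  also have "\<dots> \<le> (1 - \<delta>) * H2"
    using second_moment_delta[OF t' assms(2)] \<delta> by (intro mult_left_mono) auto
  finally show ?thesis .
qed

lemma second_moment_compressed_mean:
  assumes "t < T"
  shows "second_moment (mean (\<lambda>k \<omega>. Q (delta t k \<omega>))) \<le> 2 * (2 - \<delta>) * H2"
proof -
  have delta: "square_integrable (delta t k)" if "k \<in> {1..K}" for k
    using assms that by (rule square_integrable_delta)
  have "second_moment (mean (\<lambda>k \<omega>. Q (delta t k \<omega>)))
      \<le> (\<Sum>k = 1..K. second_moment (\<lambda>\<omega>. Q (delta t k \<omega>))) / K"
    by (intro second_moment_mean_le square_integrable_Q delta)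
  also have "\<dots> \<le> 2 * (2 - \<delta>) * H2"
  proof (rule average_le)
    fix k assume k: "k \<in> {1..K}"
    have "second_moment (\<lambda>\<omega>. Q (delta t k \<omega>)) \<le> 2 * (2 - \<delta>) * second_moment (delta t k)"
      by (intro second_moment_mono square_integrable_Q delta norm_Q_sq k)
    also have "\<dots> \<le> 2 * (2 - \<delta>) * H2"
      using second_moment_delta[OF assms k] \<delta> by (intro mult_left_mono) auto
    finally show "second_moment (\<lambda>\<omega>. Q (delta t k \<omega>)) \<le> 2 * (2 - \<delta>) * H2" .
  qed
  finally show ?thesis .
qed

text \<open>The server runs the same error recursion as a worker, fed by the mean of the compressed
  deltas instead of the scaled momentum.\<close>

lemma second_moment_sdelta:
  assumes "t < T"
  shows "second_moment (sdelta t) \<le> (2 * (2 - \<delta>) * H2) / (1 - s)\<^sup>2"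
  using assms
proof (induction t)
  case 0
  show ?case
    unfolding sdelta_def
  proof (rule second_moment_contraction)
    show "second_moment (\<lambda>\<omega>. 0::'v) \<le> (2 * (2 - \<delta>) * H2) / (1 - s)\<^sup>2"
      using \<delta> by (simp add: second_moment_zero H2_nonneg)
    show "second_moment (mean (\<lambda>k \<omega>. Q (delta 0 k \<omega>))) \<le> 2 * (2 - \<delta>) * H2"
      using 0 by (rule second_moment_compressed_mean)
  qed (use 0 s in \<open>auto simp: init[abs_def] intro!: square_integrable_const square_integrable_mean square_integrable_Q square_integrable_delta\<close>)
next
  case (Suc t)
  show ?case
    unfolding sdelta_def[of "Suc t", abs_def]
  proof (rule second_moment_contraction)
    show "second_moment (sdelta t) \<le> (2 * (2 - \<delta>) * H2) / (1 - s)\<^sup>2"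
      using Suc by simp
    show "second_moment (mean (\<lambda>k \<omega>. Q (delta (Suc t) k \<omega>))) \<le> 2 * (2 - \<delta>) * H2"
      using Suc.prems by (rule second_moment_compressed_mean)
    show "norm (serr (Suc t) \<omega>) \<le> s * norm (sdelta t \<omega>)" for \<omega>
      using Suc.prems by (simp add: serr_Suc compress)
  qed (use Suc.prems s in \<open>auto intro!: square_integrable_serr square_integrable_sdelta square_integrable_mean square_integrable_Q square_integrable_delta\<close>)
qed

lemma second_moment_serr:
  assumes "t \<le> T"
  shows "second_moment (serr t) \<le> (1 - \<delta>) * ((2 * (2 - \<delta>) * H2) / (1 - s)\<^sup>2)"
proof (cases t)
  case 0
  then show ?thesis using \<delta> H2_nonneg by (simp add: init[abs_def] second_moment_zero)
next
  case (Suc t')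
  then have t': "t' < T" using assms by simp
  have "second_moment (serr t) \<le> (1 - \<delta>) * second_moment (sdelta t')"
    using compressor assms t'
    by (intro second_moment_mono square_integrable_serr square_integrable_sdelta)
      (auto simp: Suc serr_Suc norm_minus_commute)
  also have "\<dots> \<le> (1 - \<delta>) * ((2 * (2 - \<delta>) * H2) / (1 - s)\<^sup>2)"
    using second_moment_sdelta[OF t'] \<delta> by (intro mult_left_mono) auto
  finally show ?thesis .
qed

subsection \<open>Descent along the virtual iterates\<close>

definition aux :: "nat \<Rightarrow> 'w \<Rightarrow> 'v" where "aux t \<omega> = mdl t \<omega> - (serr t \<omega> + mean (err t) \<omega>)"
text \<open>The total weight \<eta>(1 + \<mu> + \<mu>^2 + ...) with which one stochastic gradient
  acts over all later rounds.\<close>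

definition \<gamma> :: real where "\<gamma> = \<eta> / (1 - \<mu>)"
text \<open>Anticipates the displacement that the present momentum would still cause without new
  gradients: \<eta>(\<mu> + \<mu>^2 + ...) = \<mu>\<gamma> times its mean.\<close>

definition virt :: "nat \<Rightarrow> 'w \<Rightarrow> 'v" where "virt t \<omega> = aux t \<omega> - (\<mu> * \<gamma>) *\<^sub>R mean (mom t) \<omega>"
text \<open>The displacement from \<open>aux\<close> to the step-ahead point of worker
  \<open>k\<close>; the model cancels in it.\<close>

definition gap :: "nat \<Rightarrow> nat \<Rightarrow> 'w \<Rightarrow> 'v" where "gap t k \<omega> = (serr t \<omega> + mean (err t) \<omega>) - err t k \<omega>"

lemma \<gamma>_pos: "0 < \<gamma>" using \<eta> \<mu> by (simp add: \<gamma>_def)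

lemma mom_mean_Suc: "mean (mom (Suc t)) \<omega> = \<mu> *\<^sub>R mean (mom t) \<omega> + mean (sgrad t) \<omega>"
  by (simp add: mom_Suc[abs_def] mean_add mean_scaleR)

text \<open>Both compressor outputs cancel: the server's between model and server error, the
  workers' mean between server error and mean worker error.\<close>

lemma aux_Suc:
  assumes "t < T"
  shows "aux (Suc t) \<omega> = aux t \<omega> - \<eta> *\<^sub>R mean (mom (Suc t)) \<omega>"
proof -
  have "mean (err (Suc t)) \<omega> = mean (delta t) \<omega> - mean (\<lambda>k \<omega>. Q (delta t k \<omega>)) \<omega>"
    by (simp add: err_Suc[OF assms, abs_def] mean_diff)
  moreover have "mean (delta t) \<omega> = mean (err t) \<omega> + \<eta> *\<^sub>R mean (mom (Suc t)) \<omega>"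
    by (simp add: delta_def[abs_def] mean_add mean_scaleR)
  ultimately show ?thesis
    by (simp add: aux_def mdl_Suc[OF assms] serr_Suc[OF assms] sdelta_def)
qed

lemma virt_Suc:
  assumes "t < T"
  shows "virt (Suc t) \<omega> = virt t \<omega> - \<gamma> *\<^sub>R mean (sgrad t) \<omega>"
proof -
  have \<eta>_sum: "\<eta> + \<mu> * \<gamma> = \<gamma>" using \<mu> by (simp add: \<gamma>_def field_simps)
  have "virt (Suc t) \<omega> = aux t \<omega> - (\<eta> + \<mu> * \<gamma>) *\<^sub>R mean (mom (Suc t)) \<omega>"
    by (simp add: virt_def aux_Suc[OF assms] scaleR_left_distrib)
  then have "virt (Suc t) \<omega> = aux t \<omega> - \<gamma> *\<^sub>R mean (mom (Suc t)) \<omega>"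
    unfolding \<eta>_sum .
  then show ?thesis
    by (simp add: virt_def mom_mean_Suc scaleR_right_distrib mult.commute[of \<gamma> \<mu>])
qed

lemma virt_0: "virt 0 \<omega> = x0" "mean (mom 0) \<omega> = 0"
  by (simp_all add: virt_def aux_def init mean_def)

lemma square_integrable_aux: "t \<le> T \<Longrightarrow> square_integrable (aux t)"
  unfolding aux_def
  by (intro square_integrable_diff square_integrable_add square_integrable_mdl square_integrable_serr
      square_integrable_mean square_integrable_err)

lemma square_integrable_mom_mean: "t \<le> T \<Longrightarrow> square_integrable (mean (mom t))"
  by (intro square_integrable_mean square_integrable_mom)

lemma square_integrable_virt: "t \<le> T \<Longrightarrow> square_integrable (virt t)"
  unfolding virt_def
  by (intro square_integrable_diff square_integrable_scaleR square_integrable_aux square_integrable_mom_mean)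

lemma square_integrable_gap: "t \<le> T \<Longrightarrow> k \<in> {1..K} \<Longrightarrow> square_integrable (gap t k)"
  unfolding gap_def
  by (intro square_integrable_diff square_integrable_add square_integrable_serr
      square_integrable_mean square_integrable_err)

lemma adapted_virt:
  assumes "t \<le> T" shows "adapted ({1..K} \<times> {..<t}) (virt t)"
  unfolding virt_def aux_def using assms
  by (intro adapted_diff adapted_add adapted_scaleR adapted_mdl adapted_serr adapted_mean adapted_err
      adapted_mom order_refl)

text \<open>\<open>F\<close> is squeezed between its minimum and the quadratic majorant of the
  descent inequality at \<open>x0\<close>.\<close>

lemma integrable_F:
  assumes "square_integrable u"
  shows "integrable P (\<lambda>\<omega>. F (u \<omega>))"
proof -
  have F: "continuous_on UNIV F"
    using grad_F unfolding gderiv_def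
    by (meson continuous_at_imp_continuous_on has_derivative_continuous)
  have u: "square_integrable (\<lambda>\<omega>. u \<omega> - x0)"
    using assms by (intro square_integrable_diff square_integrable_const)
  let ?g = "\<lambda>\<omega>. \<bar>F xstar\<bar> + \<bar>F x0 + grad_F x0 \<bullet> (u \<omega> - x0) + L / 2 * (norm (u \<omega> - x0))\<^sup>2\<bar>"
  have "integrable P ?g"
    using u by (intro Bochner_Integration.integrable_add Bochner_Integration.integrable_abs
        square_integrable_inner square_integrable_const Bochner_Integration.integrable_mult_right
        square_integrable_norm) auto
  then show ?thesis
  proof (rule Bochner_Integration.integrable_bound)
    show "(\<lambda>\<omega>. F (u \<omega>)) \<in> borel_measurable P"
      using square_integrable_measurable[OF assms] borel_measurable_continuous_onI[OF F] by measurable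
    have "norm (F (u \<omega>)) \<le> norm (?g \<omega>)" for \<omega>
      using lipschitz_gradient_descent[OF grad_F lipschitz, of x0 "u \<omega> - x0"] minimizer[of "u \<omega>"]
      by simp
    then show "AE \<omega> in P. norm (F (u \<omega>)) \<le> norm (?g \<omega>)" by simp
  qed
qed

section \<open>Descent of the expected objective in one round\<close>

definition mean_grad_sq :: "nat \<Rightarrow> real" where
  "mean_grad_sq t = (\<Sum>k = 1..K. second_moment (grad t k)) / K"

definition mean_gap_sq :: "nat \<Rightarrow> real" where
  "mean_gap_sq t = (\<Sum>k = 1..K. second_moment (gap t k)) / K"

text \<open>Polarisation yields half the squared gradient minus half the squared difference of
  gradients. Splitting that difference at \<open>aux\<close> into a momentum and a compression part
  costs a factor 2, which cancels the half.\<close>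

lemma grad_virt_inner_le:
  "- (grad_F (virt t \<omega>) \<bullet> mean (grad t) \<omega>)
    \<le> - ((\<Sum>k = 1..K. (norm (grad t k \<omega>))\<^sup>2) / K) / 2
      + L\<^sup>2 * (\<mu> * \<gamma>)\<^sup>2 * (norm (mean (mom t) \<omega>))\<^sup>2
      + L\<^sup>2 * ((\<Sum>k = 1..K. (norm (gap t k \<omega>))\<^sup>2) / K)"
proof -
  define z where "z = virt t \<omega>"
  have "grad_F z \<bullet> grad t k \<omega> \<ge> (norm (grad t k \<omega>))\<^sup>2 / 2
      - L\<^sup>2 * (\<mu> * \<gamma>)\<^sup>2 * (norm (mean (mom t) \<omega>))\<^sup>2 - L\<^sup>2 * (norm (gap t k \<omega>))\<^sup>2" for k
  proof -
    have "(norm (grad_F z - grad t k \<omega>))\<^sup>2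
        \<le> 2 * (norm (grad_F z - grad_F (aux t \<omega>)))\<^sup>2 + 2 * (norm (grad_F (aux t \<omega>) - grad t k \<omega>))\<^sup>2"
      using norm_add_sq_le_weighted[of 1 "grad_F z - grad_F (aux t \<omega>)" "grad_F (aux t \<omega>) - grad t k \<omega>"]
      by simp
    also have "\<dots> \<le> 2 * (L\<^sup>2 * (norm (z - aux t \<omega>))\<^sup>2) + 2 * (L\<^sup>2 * (norm (aux t \<omega> - half t k \<omega>))\<^sup>2)"
      unfolding grad_def by (intro add_mono mult_left_mono lipschitz_sq) auto
    also have "norm (z - aux t \<omega>) = \<bar>\<mu> * \<gamma>\<bar> * norm (mean (mom t) \<omega>)"
      by (simp add: z_def virt_def)
    also have "norm (aux t \<omega> - half t k \<omega>) = norm (gap t k \<omega>)"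
      by (subst norm_minus_commute) (simp add: aux_def half_def gap_def algebra_simps)
    finally have "(norm (grad_F z - grad t k \<omega>))\<^sup>2 \<le> 2 * (L\<^sup>2 * (\<mu> * \<gamma>)\<^sup>2 * (norm (mean (mom t) \<omega>))\<^sup>2)
        + 2 * (L\<^sup>2 * (norm (gap t k \<omega>))\<^sup>2)"
      by (simp add: power_mult_distrib)
    moreover have "(norm (grad_F z - grad t k \<omega>))\<^sup>2
        = (norm (grad_F z))\<^sup>2 - 2 * (grad_F z \<bullet> grad t k \<omega>) + (norm (grad t k \<omega>))\<^sup>2"
      by (simp add: power2_norm_eq_inner inner_diff_left inner_diff_right inner_commute)
    \<comment> \<open>This square enters the polarisation with a favourable sign and is
      discarded.\<close>
    moreover have "0 \<le> (norm (grad_F z))\<^sup>2" by simp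
    ultimately show ?thesis by linarith
  qed
  then have "(\<Sum>k = 1..K. grad_F z \<bullet> grad t k \<omega>) \<ge> (\<Sum>k = 1..K. (norm (grad t k \<omega>))\<^sup>2 / 2
      - L\<^sup>2 * (\<mu> * \<gamma>)\<^sup>2 * (norm (mean (mom t) \<omega>))\<^sup>2 - L\<^sup>2 * (norm (gap t k \<omega>))\<^sup>2)"
    by (intro sum_mono)
  also have "(\<Sum>k = 1..K. (norm (grad t k \<omega>))\<^sup>2 / 2
      - L\<^sup>2 * (\<mu> * \<gamma>)\<^sup>2 * (norm (mean (mom t) \<omega>))\<^sup>2 - L\<^sup>2 * (norm (gap t k \<omega>))\<^sup>2)
    = real K * (((\<Sum>k = 1..K. (norm (grad t k \<omega>))\<^sup>2) / K) / 2
      - L\<^sup>2 * (\<mu> * \<gamma>)\<^sup>2 * (norm (mean (mom t) \<omega>))\<^sup>2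
      - L\<^sup>2 * ((\<Sum>k = 1..K. (norm (gap t k \<omega>))\<^sup>2) / K))"
    using K by (simp add: sum_subtractf sum_divide_distrib[symmetric] sum_distrib_left[symmetric] right_diff_distrib)
  also have "(\<Sum>k = 1..K. grad_F z \<bullet> grad t k \<omega>) = real K * (grad_F z \<bullet> mean (grad t) \<omega>)"
    using K by (simp add: mean_def inner_sum_right)
  finally show ?thesis
    using K by (simp add: z_def)
qed

lemma descent_step:
  assumes t: "t < T"
  shows "expectation (\<lambda>\<omega>. F (virt (Suc t) \<omega>)) \<le> expectation (\<lambda>\<omega>. F (virt t \<omega>))
    + \<gamma> * (- mean_grad_sq t / 2 + L\<^sup>2 * (\<mu> * \<gamma>)\<^sup>2 * second_moment (mean (mom t)) + L\<^sup>2 * mean_gap_sq t)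
    + L / 2 * \<gamma>\<^sup>2 * (mean_grad_sq t + \<sigma>\<^sup>2 / K)"
proof -
  note tT = less_imp_le[OF t] Suc_leI[OF t]
  have grad: "square_integrable (grad t k)" "square_integrable (gap t k)" if "k \<in> {1..K}" for k
    using tT that by (auto intro: square_integrable_grad square_integrable_gap)
  have virt: "square_integrable (\<lambda>\<omega>. grad_F (virt t \<omega>))"
    using tT by (intro square_integrable_grad_F square_integrable_virt)
  have mgrad: "square_integrable (mean (grad t))" by (intro square_integrable_mean grad)
  have mnoise: "square_integrable (mean (noise t))"
    using t by (intro square_integrable_mean noise_square_integrable)
  have msgrad: "square_integrable (mean (sgrad t))"
    using t by (intro square_integrable_mean square_integrable_sgrad)
  have mmom: "square_integrable (mean (mom t))" using tT by (intro square_integrable_mom_mean)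
  have int_ng: "integrable P (\<lambda>\<omega>. grad_F (virt t \<omega>) \<bullet> mean (grad t) \<omega>)"
    "integrable P (\<lambda>\<omega>. grad_F (virt t \<omega>) \<bullet> mean (noise t) \<omega>)"
    by (rule square_integrable_inner[OF virt mgrad], rule square_integrable_inner[OF virt mnoise])
  have le: "F (virt (Suc t) \<omega>) \<le> F (virt t \<omega>) - \<gamma> * (grad_F (virt t \<omega>) \<bullet> mean (grad t) \<omega>)
      - \<gamma> * (grad_F (virt t \<omega>) \<bullet> mean (noise t) \<omega>) + L / 2 * \<gamma>\<^sup>2 * (norm (mean (sgrad t) \<omega>))\<^sup>2" for \<omega>
  proof -
    have "mean (sgrad t) \<omega> = mean (grad t) \<omega> + mean (noise t) \<omega>"
      by (simp add: mean_add[symmetric] sgrad_eq[symmetric])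
    then show ?thesis
      using lipschitz_gradient_descent[OF grad_F lipschitz, of "virt t \<omega>" "- \<gamma> *\<^sub>R mean (sgrad t) \<omega>"]
      by (simp add: virt_Suc[OF t] power_mult_distrib inner_add_right distrib_left del: scaleR_add_right)
  qed
  have "expectation (\<lambda>\<omega>. F (virt (Suc t) \<omega>))
      \<le> expectation (\<lambda>\<omega>. F (virt t \<omega>) - \<gamma> * (grad_F (virt t \<omega>) \<bullet> mean (grad t) \<omega>)
      - \<gamma> * (grad_F (virt t \<omega>) \<bullet> mean (noise t) \<omega>) + L / 2 * \<gamma>\<^sup>2 * (norm (mean (sgrad t) \<omega>))\<^sup>2)"
    by (intro integral_mono le Bochner_Integration.integrable_add Bochner_Integration.integrable_diff
        Bochner_Integration.integrable_mult_right integrable_F square_integrable_virt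
        square_integrable_norm int_ng msgrad tT)
  also have "\<dots> = expectation (\<lambda>\<omega>. F (virt t \<omega>))
      - \<gamma> * expectation (\<lambda>\<omega>. grad_F (virt t \<omega>) \<bullet> mean (grad t) \<omega>)
      - \<gamma> * expectation (\<lambda>\<omega>. grad_F (virt t \<omega>) \<bullet> mean (noise t) \<omega>)
      + L / 2 * \<gamma>\<^sup>2 * second_moment (mean (sgrad t))"
    using integrable_F[OF square_integrable_virt[OF tT(1)]] int_ng square_integrable_norm[OF msgrad]
    by (simp add: second_moment_def)
  \<comment> \<open>The virtual iterate depends on earlier rounds only, so the term linear in the
    noise vanishes.\<close>
  also have "expectation (\<lambda>\<omega>. grad_F (virt t \<omega>) \<bullet> mean (noise t) \<omega>) = 0"
    by (intro mean_noise_orthogonal[OF t _ virt] adapted_compose[OF grad_F_measurable] adapted_virt tT)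
  finally have "expectation (\<lambda>\<omega>. F (virt (Suc t) \<omega>)) \<le> expectation (\<lambda>\<omega>. F (virt t \<omega>))
      - \<gamma> * expectation (\<lambda>\<omega>. grad_F (virt t \<omega>) \<bullet> mean (grad t) \<omega>)
      + L / 2 * \<gamma>\<^sup>2 * second_moment (mean (sgrad t))"
    by simp
  moreover have "- \<gamma> * expectation (\<lambda>\<omega>. grad_F (virt t \<omega>) \<bullet> mean (grad t) \<omega>)
      \<le> \<gamma> * (- mean_grad_sq t / 2 + L\<^sup>2 * (\<mu> * \<gamma>)\<^sup>2 * second_moment (mean (mom t)) + L\<^sup>2 * mean_gap_sq t)"
  proof -
    define p where "p \<omega> = (\<Sum>k = 1..K. (norm (grad t k \<omega>))\<^sup>2) / K" for \<omega>
    define q where "q \<omega> = (\<Sum>k = 1..K. (norm (gap t k \<omega>))\<^sup>2) / K" for \<omega>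
    have p: "integrable P p" and q: "integrable P q"
      unfolding p_def q_def
      by (intro Bochner_Integration.integrable_divide Bochner_Integration.integrable_sum
          square_integrable_norm grad; simp)+
    have "expectation (\<lambda>\<omega>. - (grad_F (virt t \<omega>) \<bullet> mean (grad t) \<omega>))
      \<le> expectation (\<lambda>\<omega>. - p \<omega> / 2 + L\<^sup>2 * (\<mu> * \<gamma>)\<^sup>2 * (norm (mean (mom t) \<omega>))\<^sup>2 + L\<^sup>2 * q \<omega>)"
      by (intro integral_mono grad_virt_inner_le[of t, folded p_def q_def] Bochner_Integration.integrable_add
          Bochner_Integration.integrable_mult_right Bochner_Integration.integrable_divide
          Bochner_Integration.integrable_minus p q square_integrable_norm mmom int_ng)
    also have "\<dots> = - expectation p / 2
      + L\<^sup>2 * (\<mu> * \<gamma>)\<^sup>2 * expectation (\<lambda>\<omega>. (norm (mean (mom t) \<omega>))\<^sup>2) + L\<^sup>2 * expectation q"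
      using p q square_integrable_norm[OF mmom] by simp
    also have "expectation p = mean_grad_sq t"
      using grad(1) by (simp add: p_def[abs_def] mean_grad_sq_def second_moment_def square_integrable_norm)
    also have "expectation q = mean_gap_sq t"
      using grad(2) by (simp add: q_def[abs_def] mean_gap_sq_def second_moment_def square_integrable_norm)
    finally have "- expectation (\<lambda>\<omega>. grad_F (virt t \<omega>) \<bullet> mean (grad t) \<omega>)
        \<le> - mean_grad_sq t / 2 + L\<^sup>2 * (\<mu> * \<gamma>)\<^sup>2 * second_moment (mean (mom t)) + L\<^sup>2 * mean_gap_sq t"
      by (simp add: second_moment_def)
    from mult_left_mono[OF this less_imp_le[OF \<gamma>_pos]] show ?thesis by simp
  qed
  moreover have "L / 2 * \<gamma>\<^sup>2 * second_moment (mean (sgrad t)) \<le> L / 2 * \<gamma>\<^sup>2 * (mean_grad_sq t + \<sigma>\<^sup>2 / K)"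
    unfolding mean_grad_sq_def using L_nonneg
    by (intro mult_left_mono second_moment_sgrad_mean[OF t]) simp
  ultimately show ?thesis by linarith
qed

text \<open>In contrast to \<open>second_moment_mom\<close>, the current squared gradients are kept,
  so that the descent can absorb them, and the noise keeps its factor 1/K.\<close>

lemma mom_mean_step:
  assumes t: "t < T"
  shows "second_moment (mean (mom (Suc t)))
    \<le> \<mu> * second_moment (mean (mom t)) + (1 / (1 - \<mu>)) * (mean_grad_sq t + \<sigma>\<^sup>2 / K)"
proof -
  have "second_moment (mean (mom (Suc t)))
    \<le> \<mu> * second_moment (mean (mom t)) + (1 / (1 - \<mu>)) * second_moment (mean (sgrad t))"
  proof (rule second_moment_le_weighted)
    show "(norm (mean (mom (Suc t)) \<omega>))\<^sup>2
        \<le> \<mu> * (norm (mean (mom t) \<omega>))\<^sup>2 + (1 / (1 - \<mu>)) * (norm (mean (sgrad t) \<omega>))\<^sup>2" for \<omega>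
      using norm_contraction_add_sq[of "\<mu> *\<^sub>R mean (mom t) \<omega>" \<mu> "mean (mom t) \<omega>"] \<mu>
      by (simp add: mom_mean_Suc)
  qed (use t in \<open>auto intro!: square_integrable_mean square_integrable_mom square_integrable_sgrad\<close>)
  also have "\<dots> \<le> \<mu> * second_moment (mean (mom t)) + (1 / (1 - \<mu>)) * (mean_grad_sq t + \<sigma>\<^sup>2 / K)"
    unfolding mean_grad_sq_def using \<mu> second_moment_sgrad_mean[OF t]
    by (intro add_left_mono mult_left_mono) auto
  finally show ?thesis .
qed

section \<open>The constants and the potential argument\<close>

definition R2 :: real where "R2 = (1 - \<delta>) * H2"
definition C :: real where
  "C = 2 * (1 + \<delta>) * (2 - \<delta>) / (1 - s)\<^sup>2 + (1 + \<delta>) / \<delta>"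
definition \<alpha> :: real where
  "\<alpha> = 1 - \<eta> * L / (1 - \<mu>) - 2 * \<mu>\<^sup>2 * \<eta>\<^sup>2 * L\<^sup>2 / (1 - \<mu>) ^ 4"

text \<open>Young's inequality with parameter \<delta> separates the server error from the deviation
  of a worker error from the mean; the two parts give the two summands of \<open>C\<close>.\<close>

lemma mean_gap_sq_le:
  assumes t: "t \<le> T"
  shows "mean_gap_sq t \<le> C * R2"
proof -
  have err: "square_integrable (err t k)" if "k \<in> {1..K}" for k
    using t that by (rule square_integrable_err)
  have serr: "square_integrable (serr t)" using t by (rule square_integrable_serr)
  have dev: "square_integrable (\<lambda>\<omega>. mean (err t) \<omega> - err t k \<omega>)" if "k \<in> {1..K}" for k
    using that by (intro square_integrable_diff square_integrable_mean err)
  have "second_moment (gap t k) \<le> (1 + \<delta>) * second_moment (serr t)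
      + (1 + 1 / \<delta>) * second_moment (\<lambda>\<omega>. mean (err t) \<omega> - err t k \<omega>)" if k: "k \<in> {1..K}" for k
    using norm_add_sq_le_weighted[OF \<delta>(1), of "serr t _"] t k
    by (intro second_moment_le_weighted dev serr square_integrable_gap)
      (auto simp: gap_def add_diff_eq[symmetric])
  then have "(\<Sum>k = 1..K. second_moment (gap t k)) \<le> (\<Sum>k = 1..K. (1 + \<delta>) * second_moment (serr t)
      + (1 + 1 / \<delta>) * second_moment (\<lambda>\<omega>. mean (err t) \<omega> - err t k \<omega>))"
    by (intro sum_mono)
  also have "\<dots> = real K * ((1 + \<delta>) * second_moment (serr t))
      + (1 + 1 / \<delta>) * (\<Sum>k = 1..K. second_moment (\<lambda>\<omega>. mean (err t) \<omega> - err t k \<omega>))"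
    by (simp add: sum.distrib sum_distrib_left)
  also have "(\<Sum>k = 1..K. second_moment (\<lambda>\<omega>. mean (err t) \<omega> - err t k \<omega>)) \<le> real K * R2"
  proof -
    \<comment> \<open>Centring costs nothing once the squares are summed over the workers; a bound
      for each worker alone would lose a constant factor.\<close>
    have "(\<Sum>k = 1..K. (norm (mean (err t) \<omega> - err t k \<omega>))\<^sup>2) \<le> (\<Sum>k = 1..K. (norm (err t k \<omega>))\<^sup>2)" for \<omega>
    proof -
      have "(\<Sum>k = 1..K. (norm (mean (err t) \<omega> - err t k \<omega>))\<^sup>2) / K \<le> (\<Sum>k = 1..K. (norm (err t k \<omega>))\<^sup>2) / K"
        using norm_sq_mean_add_deviation[OF K mean_def[of "err t" \<omega>]] zero_le_power2[of "norm (mean (err t) \<omega>)"]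
        by linarith
      then show ?thesis using K by (simp add: divide_le_cancel)
    qed
    then have "expectation (\<lambda>\<omega>. \<Sum>k = 1..K. (norm (mean (err t) \<omega> - err t k \<omega>))\<^sup>2)
        \<le> expectation (\<lambda>\<omega>. \<Sum>k = 1..K. (norm (err t k \<omega>))\<^sup>2)"
      by (intro integral_mono Bochner_Integration.integrable_sum square_integrable_norm dev err)
    then have "(\<Sum>k = 1..K. second_moment (\<lambda>\<omega>. mean (err t) \<omega> - err t k \<omega>)) \<le> (\<Sum>k = 1..K. second_moment (err t k))"
      by (simp add: second_moment_def square_integrable_norm dev err)
    also have "\<dots> \<le> (\<Sum>k = 1..K. R2)"
      unfolding R2_def using t by (intro sum_mono second_moment_err)
    finally show ?thesis by simp
  qed
  also have "second_moment (serr t) \<le> 2 * (2 - \<delta>) / (1 - s)\<^sup>2 * R2"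
    using second_moment_serr[OF t] by (simp add: R2_def algebra_simps)
  finally have "(\<Sum>k = 1..K. second_moment (gap t k))
      \<le> real K * ((1 + \<delta>) * (2 * (2 - \<delta>) / (1 - s)\<^sup>2 * R2)) + (1 + 1 / \<delta>) * (real K * R2)"
    using \<delta> by (simp add: mult_left_mono)
  also have "\<dots> = real K * (C * R2)"
  proof -
    have "1 + 1 / \<delta> = (1 + \<delta>) / \<delta>" using \<delta> by (simp add: field_simps)
    then show ?thesis by (simp add: C_def algebra_simps)
  qed
  finally show ?thesis using K by (simp add: mean_gap_sq_def field_simps)
qed

text \<open>The first summand is the smoothness cost of a step of size \<gamma>, the second the cost
  of the momentum term in the potential.\<close>

lemma one_minus_\<alpha>: "1 - \<alpha> = \<gamma> * L + 2 * L\<^sup>2 * (\<mu> * \<gamma>)\<^sup>2 / (1 - \<mu>)\<^sup>2"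
  using \<mu> by (simp add: \<alpha>_def \<gamma>_def power_mult_distrib power_divide flip: power_add power2_eq_square)

lemma gradient_sum_le:
  assumes n: "n \<le> T"
  shows "expectation (\<lambda>\<omega>. F (virt n \<omega>))
      + \<gamma> * L\<^sup>2 * (\<mu> * \<gamma>)\<^sup>2 / (1 - \<mu>) * second_moment (mean (mom n))
      + \<gamma> * \<alpha> / 2 * (\<Sum>t<n. mean_grad_sq t)
    \<le> F x0 + real n * (\<gamma> * L\<^sup>2 * (C * R2) + \<gamma> / 2 * (1 - \<alpha>) * \<sigma>\<^sup>2 / K)"
  using n
proof (induction n)
  case 0
  then show ?case by (simp add: virt_0[abs_def] second_moment_zero prob_space)
next
  case (Suc n)
  then have n: "n < T" by simp
  define b where "b = mean_grad_sq n"
  define v where "v = second_moment (mean (mom n))"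
  define v' where "v' = second_moment (mean (mom (Suc n)))"
  define a where "a = L\<^sup>2 * (\<mu> * \<gamma>)\<^sup>2"
  define N where "N = \<sigma>\<^sup>2 / K"
  \<comment> \<open>The weight solves \<open>c * \<mu> + \<gamma> * a = c\<close>: the momentum
    surviving the round and the momentum term of the descent step together reproduce the
    potential.\<close>
  define c where "c = \<gamma> * a / (1 - \<mu>)"
  have c: "0 \<le> c" "c * (1 - \<mu>) = \<gamma> * a" using \<gamma>_pos \<mu> by (auto simp: c_def a_def)
  have "v' \<le> \<mu> * v + (1 / (1 - \<mu>)) * (b + N)"
    unfolding v'_def v_def b_def N_def by (rule mom_mean_step[OF n])
  from mult_left_mono[OF this c(1)]
  have v': "c * v' \<le> c * \<mu> * v + c / (1 - \<mu>) * (b + N)" by (simp add: algebra_simps)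
  have gap: "\<gamma> * (L\<^sup>2 * mean_gap_sq n) \<le> \<gamma> * (L\<^sup>2 * (C * R2))"
    using mean_gap_sq_le[of n] n \<gamma>_pos by (intro mult_left_mono) auto
  have step: "expectation (\<lambda>\<omega>. F (virt (Suc n) \<omega>)) \<le> expectation (\<lambda>\<omega>. F (virt n \<omega>))
      + \<gamma> * (- b / 2 + a * v + L\<^sup>2 * mean_gap_sq n) + L / 2 * \<gamma>\<^sup>2 * (b + N)"
    using descent_step[OF n] by (simp add: a_def b_def v_def N_def)
  \<comment> \<open>The common coefficient of squared gradients and noise. Against the gain
    \<gamma>/2 of the descent step it leaves \<gamma>\<alpha>/2 for the gradients, which explains
    the form of \<alpha>.\<close>
  have coeff: "c / (1 - \<mu>) + L / 2 * \<gamma>\<^sup>2 = \<gamma> / 2 * (1 - \<alpha>)"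
    unfolding one_minus_\<alpha> c_def a_def using \<mu> by (simp add: field_simps power2_eq_square)
  have "c / (1 - \<mu>) * (b + N) + L / 2 * \<gamma>\<^sup>2 * (b + N) = \<gamma> / 2 * (1 - \<alpha>) * (b + N)"
    unfolding coeff[symmetric] by (rule distrib_right[symmetric])
  also have "\<dots> = \<gamma> * b / 2 - \<gamma> * \<alpha> / 2 * b + \<gamma> / 2 * (1 - \<alpha>) * N"
    by (simp add: algebra_simps add_divide_distrib diff_divide_distrib)
  finally have noise: "c / (1 - \<mu>) * (b + N) + L / 2 * \<gamma>\<^sup>2 * (b + N)
    = \<gamma> * b / 2 - \<gamma> * \<alpha> / 2 * b + \<gamma> / 2 * (1 - \<alpha>) * N" .
  have "c * \<mu> * v + \<gamma> * (a * v) = (c * \<mu> + \<gamma> * a) * v" by (simp add: distrib_right)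
  also have "c * \<mu> + \<gamma> * a = c" unfolding c(2)[symmetric] by (simp add: right_diff_distrib)
  finally have mom: "c * \<mu> * v + \<gamma> * (a * v) = c * v" .
  have "expectation (\<lambda>\<omega>. F (virt (Suc n) \<omega>)) + c * v' + \<gamma> * \<alpha> / 2 * b
      \<le> expectation (\<lambda>\<omega>. F (virt n \<omega>)) + (- \<gamma> * b / 2 + \<gamma> * (a * v) + \<gamma> * (L\<^sup>2 * mean_gap_sq n))
        + L / 2 * \<gamma>\<^sup>2 * (b + N) + (c * \<mu> * v + c / (1 - \<mu>) * (b + N)) + \<gamma> * \<alpha> / 2 * b"
    using add_mono[OF step v'] by (simp add: distrib_left right_diff_distrib)
  also have "\<dots> \<le> expectation (\<lambda>\<omega>. F (virt n \<omega>)) + c * v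
      + (\<gamma> * L\<^sup>2 * (C * R2) + \<gamma> / 2 * (1 - \<alpha>) * N)"
    using noise mom gap by (simp add: mult.assoc)
  finally have "expectation (\<lambda>\<omega>. F (virt (Suc n) \<omega>)) + c * v' + \<gamma> * \<alpha> / 2 * b
      \<le> expectation (\<lambda>\<omega>. F (virt n \<omega>)) + c * v
        + (\<gamma> * L\<^sup>2 * (C * R2) + \<gamma> / 2 * (1 - \<alpha>) * N)" .
  moreover have "expectation (\<lambda>\<omega>. F (virt n \<omega>)) + c * v + \<gamma> * \<alpha> / 2 * (\<Sum>t<n. mean_grad_sq t)
      \<le> F x0 + real n * (\<gamma> * L\<^sup>2 * (C * R2) + \<gamma> / 2 * (1 - \<alpha>) * N)"
    using Suc.IH n by (simp add: c_def a_def v_def N_def mult.assoc)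
  ultimately have "expectation (\<lambda>\<omega>. F (virt (Suc n) \<omega>)) + c * v' + \<gamma> * \<alpha> / 2 * (\<Sum>t<Suc n. mean_grad_sq t)
      \<le> F x0 + real (Suc n) * (\<gamma> * L\<^sup>2 * (C * R2) + \<gamma> / 2 * (1 - \<alpha>) * N)"
    by (simp add: b_def distrib_left distrib_right add_divide_distrib)
  then show ?case by (simp add: c_def a_def v'_def N_def mult.assoc)
qed

text \<open>The final potential is at least \<open>F xstar\<close>, since its momentum part is
  nonnegative; it remains to divide by \<gamma>\<alpha>T/2.\<close>

lemma mean_gradient_le:
  assumes T: "1 \<le> T" and \<alpha>: "0 < \<alpha>"
  shows "(\<Sum>t<T. mean_grad_sq t) / T \<le> 2 * (F x0 - F xstar) / (\<alpha> * \<gamma> * T)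
    + (1 - \<alpha>) * \<sigma>\<^sup>2 / (\<alpha> * K) + 2 * L\<^sup>2 * (C * R2) / \<alpha>"
proof -
  have "F xstar \<le> expectation (\<lambda>\<omega>. F (virt T \<omega>))"
    using minimizer by (intro integral_ge_const integrable_F square_integrable_virt) auto
  moreover have "0 \<le> \<gamma> * L\<^sup>2 * (\<mu> * \<gamma>)\<^sup>2 / (1 - \<mu>) * second_moment (mean (mom T))"
    using \<gamma>_pos \<mu> by (intro mult_nonneg_nonneg divide_nonneg_nonneg second_moment_nonneg) auto
  ultimately have "\<gamma> * \<alpha> / 2 * (\<Sum>t<T. mean_grad_sq t)
      \<le> F x0 - F xstar + real T * (\<gamma> * L\<^sup>2 * (C * R2) + \<gamma> / 2 * (1 - \<alpha>) * \<sigma>\<^sup>2 / K)"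
    using gradient_sum_le[of T] by linarith
  then have "(\<Sum>t<T. mean_grad_sq t) / T \<le> (F x0 - F xstar
      + real T * (\<gamma> * L\<^sup>2 * (C * R2) + \<gamma> / 2 * (1 - \<alpha>) * \<sigma>\<^sup>2 / K)) / (\<gamma> * \<alpha> / 2) / T"
    using \<gamma>_pos \<alpha> by (intro divide_right_mono) (simp_all add: pos_le_divide_eq mult.commute)
  also have "\<dots> = 2 * (F x0 - F xstar) / (\<alpha> * \<gamma> * T)
    + (1 - \<alpha>) * \<sigma>\<^sup>2 / (\<alpha> * K) + 2 * L\<^sup>2 * (C * R2) / \<alpha>"
    using T \<alpha> \<gamma>_pos K by (simp add: field_simps)
  finally show ?thesis .
qed

text \<open>Both claims are instances for a suitable \<open>u\<close>, differing only in the mean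
  square distance \<open>B\<close> to the step-ahead points.\<close>

lemma min_gradient_le:
  assumes T: "1 \<le> T" and \<alpha>: "0 < \<alpha>"
    and u: "\<And>t. t < T \<Longrightarrow> square_integrable (u t)"
    and B: "\<And>t. t < T \<Longrightarrow> (\<Sum>k = 1..K. second_moment (\<lambda>\<omega>. u t \<omega> - half t k \<omega>)) / K \<le> B"
  shows "(MIN t \<in> {..<T}. second_moment (\<lambda>\<omega>. grad_F (u t \<omega>)))
    \<le> 4 * (F x0 - F xstar) / (\<alpha> * \<gamma> * T) + 2 * (1 - \<alpha>) * \<sigma>\<^sup>2 / (\<alpha> * K)
      + 4 * L\<^sup>2 * (C * R2) / \<alpha> + 2 * L\<^sup>2 * B"
proof -
  define m where "m = (MIN t \<in> {..<T}. second_moment (\<lambda>\<omega>. grad_F (u t \<omega>)))"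
  have "m \<le> 2 * mean_grad_sq t + 2 * L\<^sup>2 * B" if t: "t < T" for t
  proof -
    have "m \<le> second_moment (\<lambda>\<omega>. grad_F (u t \<omega>))"
      unfolding m_def using t by (intro Min_le) auto
    \<comment> \<open>One point \<open>u t\<close> is compared with the step-ahead points of all
      workers, because the descent controls only the average over workers.\<close>
    also have "\<dots> \<le> (\<Sum>k = 1..K. 2 * second_moment (grad t k)
        + 2 * L\<^sup>2 * second_moment (\<lambda>\<omega>. u t \<omega> - half t k \<omega>)) / K"
    proof (rule average_ge)
      fix k assume "k \<in> {1..K}"
      then have "square_integrable (grad t k)" "square_integrable (half t k)"
        using t unfolding half_def
        by (auto intro!: square_integrable_grad square_integrable_diff square_integrable_mdl square_integrable_err)
      then show "second_moment (\<lambda>\<omega>. grad_F (u t \<omega>)) \<le> 2 * second_moment (grad t k)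
          + 2 * L\<^sup>2 * second_moment (\<lambda>\<omega>. u t \<omega> - half t k \<omega>)"
        using u[OF t] by (intro second_moment_le_weighted square_integrable_grad_F square_integrable_diff)
          (auto simp: grad_def grad_sq_le)
    qed
    also have "\<dots> = 2 * mean_grad_sq t
        + 2 * L\<^sup>2 * ((\<Sum>k = 1..K. second_moment (\<lambda>\<omega>. u t \<omega> - half t k \<omega>)) / K)"
      by (simp add: mean_grad_sq_def sum.distrib sum_distrib_left[symmetric] add_divide_distrib)
    also have "\<dots> \<le> 2 * mean_grad_sq t + 2 * L\<^sup>2 * B"
      using B[OF t] by (intro add_left_mono mult_left_mono) auto
    finally show ?thesis .
  qed
  then have "(\<Sum>t<T. m) \<le> (\<Sum>t<T. 2 * mean_grad_sq t + 2 * L\<^sup>2 * B)" by (intro sum_mono) auto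
  then have "real T * m \<le> real T * (2 * ((\<Sum>t<T. mean_grad_sq t) / T) + 2 * L\<^sup>2 * B)"
    using T by (simp add: sum.distrib sum_distrib_left[symmetric] distrib_left)
  then have "m \<le> 2 * ((\<Sum>t<T. mean_grad_sq t) / T) + 2 * L\<^sup>2 * B"
    using T by simp
  also have "\<dots> \<le> 2 * (2 * (F x0 - F xstar) / (\<alpha> * \<gamma> * T)
    + (1 - \<alpha>) * \<sigma>\<^sup>2 / (\<alpha> * K) + 2 * L\<^sup>2 * (C * R2) / \<alpha>) + 2 * L\<^sup>2 * B"
    using mean_gradient_le[OF T \<alpha>] by (intro add_right_mono mult_left_mono) auto
  finally show ?thesis by (simp add: m_def algebra_simps)
qed

lemma bound_terms:
  shows "4 * (F x0 - F xstar) / (\<alpha> * \<gamma> * T) = 4 * (1 - \<mu>) * (F x0 - F xstar) / (\<alpha> * \<eta> * real T)"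
    and "2 * (1 - \<alpha>) * \<sigma>\<^sup>2 / (\<alpha> * K)
      = 2 * (1 + 2 * \<mu>\<^sup>2 * \<eta> * L / (1 - \<mu>) ^ 3) * \<eta> * L * \<sigma>\<^sup>2 / (\<alpha> * (1 - \<mu>) * real K)"
    and "R2 = (1 - \<delta>) / (1 - s)\<^sup>2 * (\<eta>\<^sup>2 * (M\<^sup>2 + \<sigma>\<^sup>2) / (1 - \<mu>)\<^sup>2)"
proof -
  show "4 * (F x0 - F xstar) / (\<alpha> * \<gamma> * T) = 4 * (1 - \<mu>) * (F x0 - F xstar) / (\<alpha> * \<eta> * real T)"
    unfolding \<gamma>_def by (simp only: times_divide_eq_right times_divide_eq_left divide_divide_eq_right mult_ac)
  \<comment> \<open>The bracket in the noise term of the claim, left after factoring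
    \<eta>L/(1-\<mu>) out of \<open>1 - \<alpha>\<close>.\<close>
  define Y where "Y = 1 + 2 * \<mu>\<^sup>2 * \<eta> * L / (1 - \<mu>) ^ 3"
  have "(1 - \<mu>) ^ 4 = (1 - \<mu>) ^ 3 * (1 - \<mu>)" by (simp add: power3_eq_cube power4_eq_xxxx)
  then have "1 - \<alpha> = Y * (\<eta> * L / (1 - \<mu>))"
    by (simp add: \<alpha>_def Y_def distrib_left add_divide_distrib power2_eq_square mult_ac)
  then have "2 * (1 - \<alpha>) * \<sigma>\<^sup>2 / (\<alpha> * K) = 2 * Y * \<eta> * L * \<sigma>\<^sup>2 / (\<alpha> * (1 - \<mu>) * real K)"
    by (simp add: mult_ac)
  then show "2 * (1 - \<alpha>) * \<sigma>\<^sup>2 / (\<alpha> * K)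
      = 2 * (1 + 2 * \<mu>\<^sup>2 * \<eta> * L / (1 - \<mu>) ^ 3) * \<eta> * L * \<sigma>\<^sup>2 / (\<alpha> * (1 - \<mu>) * real K)"
    by (simp only: Y_def)
  show "R2 = (1 - \<delta>) / (1 - s)\<^sup>2 * (\<eta>\<^sup>2 * (M\<^sup>2 + \<sigma>\<^sup>2) / (1 - \<mu>)\<^sup>2)"
    by (simp add: R2_def H2_def G2_def)
qed

text \<open>The displacement to a step-ahead point is the worker error, so \<open>B = R2\<close>;
  writing its contribution over the denominator \<alpha> produces the summand 2\<alpha>.\<close>

lemma min_gradient_model_le:
  assumes T: "1 \<le> T" and \<alpha>: "0 < \<alpha>"
  shows "(MIN t \<in> {..<T}. second_moment (\<lambda>\<omega>. grad_F (mdl t \<omega>)))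
    \<le> 4 * (1 - \<mu>) * (F x0 - F xstar) / (\<alpha> * \<eta> * real T)
      + 2 * (1 + 2 * \<mu>\<^sup>2 * \<eta> * L / (1 - \<mu>) ^ 3) * \<eta> * L * \<sigma>\<^sup>2 / (\<alpha> * (1 - \<mu>) * real K)
      + (4 * C + 2 * \<alpha>) * ((1 - \<delta>) / (1 - s)\<^sup>2) * (\<eta>\<^sup>2 * L\<^sup>2 * (M\<^sup>2 + \<sigma>\<^sup>2) / (\<alpha> * (1 - \<mu>)\<^sup>2))"
proof -
  have "(\<Sum>k = 1..K. second_moment (\<lambda>\<omega>. mdl t \<omega> - half t k \<omega>)) / K \<le> R2" if "t < T" for t
    using that by (intro average_le) (simp add: half_def second_moment_err R2_def)
  from min_gradient_le[OF T \<alpha> square_integrable_mdl[OF less_imp_le] this]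
  have "(MIN t \<in> {..<T}. second_moment (\<lambda>\<omega>. grad_F (mdl t \<omega>)))
    \<le> 4 * (F x0 - F xstar) / (\<alpha> * \<gamma> * T) + 2 * (1 - \<alpha>) * \<sigma>\<^sup>2 / (\<alpha> * K)
      + 4 * L\<^sup>2 * (C * R2) / \<alpha> + 2 * L\<^sup>2 * R2"
    by simp
  also have "4 * L\<^sup>2 * (C * R2) / \<alpha> + 2 * L\<^sup>2 * R2 = (4 * C + 2 * \<alpha>) * (L\<^sup>2 * R2 / \<alpha>)"
    using \<alpha> by (simp add: field_simps)
  then have "4 * (F x0 - F xstar) / (\<alpha> * \<gamma> * T) + 2 * (1 - \<alpha>) * \<sigma>\<^sup>2 / (\<alpha> * K)
      + 4 * L\<^sup>2 * (C * R2) / \<alpha> + 2 * L\<^sup>2 * R2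
    = 4 * (F x0 - F xstar) / (\<alpha> * \<gamma> * T) + 2 * (1 - \<alpha>) * \<sigma>\<^sup>2 / (\<alpha> * K)
      + (4 * C + 2 * \<alpha>) * (L\<^sup>2 * R2 / \<alpha>)" by simp
  also have "(4 * C + 2 * \<alpha>) * (L\<^sup>2 * R2 / \<alpha>)
      = (4 * C + 2 * \<alpha>) * ((1 - \<delta>) / (1 - s)\<^sup>2) * (\<eta>\<^sup>2 * L\<^sup>2 * (M\<^sup>2 + \<sigma>\<^sup>2) / (\<alpha> * (1 - \<mu>)\<^sup>2))"
    unfolding bound_terms(3) by (simp add: mult_ac)
  finally show ?thesis unfolding bound_terms .
qed

text \<open>The displacement is, up to sign, the gap of the descent step, so
  \<open>B = C * R2\<close> and \<open>C\<close> multiplies both summands.\<close>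

lemma min_gradient_aux_le:
  assumes T: "1 \<le> T" and \<alpha>: "0 < \<alpha>"
  shows "(MIN t \<in> {..<T}. second_moment (\<lambda>\<omega>. grad_F (aux t \<omega>)))
    \<le> 4 * (1 - \<mu>) * (F x0 - F xstar) / (\<alpha> * \<eta> * real T)
      + 2 * (1 + 2 * \<mu>\<^sup>2 * \<eta> * L / (1 - \<mu>) ^ 3) * \<eta> * L * \<sigma>\<^sup>2 / (\<alpha> * (1 - \<mu>) * real K)
      + (4 / \<alpha> + 2) * (C * (1 - \<delta>) / (1 - s)\<^sup>2) * (\<eta>\<^sup>2 * L\<^sup>2 * (M\<^sup>2 + \<sigma>\<^sup>2) / (1 - \<mu>)\<^sup>2)"
proof -
  have "second_moment (\<lambda>\<omega>. aux t \<omega> - half t k \<omega>) = second_moment (gap t k)" for t k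
    unfolding second_moment_def
    by (subst norm_minus_commute) (simp add: aux_def half_def gap_def algebra_simps)
  then have "(\<Sum>k = 1..K. second_moment (\<lambda>\<omega>. aux t \<omega> - half t k \<omega>)) / K \<le> C * R2" if "t < T" for t
    using mean_gap_sq_le[of t] that by (simp add: mean_gap_sq_def)
  from min_gradient_le[OF T \<alpha> square_integrable_aux[OF less_imp_le] this]
  have "(MIN t \<in> {..<T}. second_moment (\<lambda>\<omega>. grad_F (aux t \<omega>)))
    \<le> 4 * (F x0 - F xstar) / (\<alpha> * \<gamma> * T) + 2 * (1 - \<alpha>) * \<sigma>\<^sup>2 / (\<alpha> * K)
      + 4 * L\<^sup>2 * (C * R2) / \<alpha> + 2 * L\<^sup>2 * (C * R2)"
    by simp
  also have "\<dots> = 4 * (F x0 - F xstar) / (\<alpha> * \<gamma> * T) + 2 * (1 - \<alpha>) * \<sigma>\<^sup>2 / (\<alpha> * K)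
      + (4 / \<alpha> + 2) * (L\<^sup>2 * (C * R2))"
    by (simp add: algebra_simps)
  also have "(4 / \<alpha> + 2) * (L\<^sup>2 * (C * R2))
      = (4 / \<alpha> + 2) * (C * (1 - \<delta>) / (1 - s)\<^sup>2) * (\<eta>\<^sup>2 * L\<^sup>2 * (M\<^sup>2 + \<sigma>\<^sup>2) / (1 - \<mu>)\<^sup>2)"
    unfolding bound_terms(3) by (simp add: mult_ac)
  finally show ?thesis unfolding bound_terms .
qed

end

theorem theorem3:
  fixes D :: "'z measure" and P :: "'w measure"
    and f :: "real ^ 'd \<Rightarrow> 'z \<Rightarrow> real" and grad_f :: "real ^ 'd \<Rightarrow> 'z \<Rightarrow> real ^ 'd"
    and F :: "real ^ 'd \<Rightarrow> real" and grad_F :: "real ^ 'd \<Rightarrow> real ^ 'd"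
    and \<xi> :: "nat \<Rightarrow> nat \<Rightarrow> 'w \<Rightarrow> 'z"
    and Q :: "real ^ 'd \<Rightarrow> real ^ 'd"
    and x0 xstar :: "real ^ 'd"
    and K T :: nat
    and \<mu> L \<sigma> M \<delta> \<eta> \<alpha> C :: real
    and lr :: "nat \<Rightarrow> real"
    and S :: "nat \<Rightarrow> 'w \<Rightarrow> (real ^ 'd) saef_state"
  assumes prob_D: "prob_space D" and prob_P: "prob_space P"
    and K: "K \<ge> 1" and T: "T \<ge> 1"
    \<comment> \<open>objective and stochastic gradients\<close>
    and f_integrable: "\<And>x. integrable D (f x)"
    and F_eq: "\<And>x. F x = (\<integral>z. f x z \<partial>D)"
    and grad_f: "\<And>x z. z \<in> space D \<Longrightarrow> GDERIV (\<lambda>y. f y z) x :> grad_f x z"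
    and grad_F: "\<And>x. GDERIV F x :> grad_F x"
    and unbiased: "\<And>x. integrable D (grad_f x)" "\<And>x. (\<integral>z. grad_f x z \<partial>D) = grad_F x"
    and minimizer: "\<And>x. F xstar \<le> F x"
    \<comment> \<open>samples\<close>
    and indep: "prob_space.indep_vars P (\<lambda>_. D) (\<lambda>(k, t). \<xi> k t) ({1..K} \<times> {..<T})"
    and law: "\<And>k t. k \<in> {1..K} \<Longrightarrow> t < T \<Longrightarrow> distr P D (\<xi> k t) = D"
    \<comment> \<open>algorithm\<close>
    and Q_measurable: "Q \<in> borel_measurable borel"
    and \<mu>: "0 \<le> \<mu>" "\<mu> < 1"
    and \<eta>: "0 < \<eta>" and lr: "\<And>t. t < T \<Longrightarrow> lr t = \<eta>"
    and S: "\<And>t \<omega>. S t \<omega> = saef_sgd Q \<mu> K lr (\<lambda>t k x. grad_f x (\<xi> k t \<omega>)) x0 t"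
    \<comment> \<open>Lipschitz gradient\<close>
    and lipschitz: "\<And>x y. norm (grad_F x - grad_F y) \<le> L * norm (x - y)"
    \<comment> \<open>bounded variance at the iterates\<close>
    and variance:
      "\<And>k t. k \<in> {1..K} \<Longrightarrow> t < T \<Longrightarrow>
         integrable P (\<lambda>\<omega>. (norm (grad_f (worker_model (S t \<omega>) k) (\<xi> k t \<omega>)
                               - grad_F (worker_model (S t \<omega>) k)))\<^sup>2)"
      "\<And>k t. k \<in> {1..K} \<Longrightarrow> t < T \<Longrightarrow>
         (\<integral>\<omega>. (norm (grad_f (worker_model (S t \<omega>) k) (\<xi> k t \<omega>)
                   - grad_F (worker_model (S t \<omega>) k)))\<^sup>2 \<partial>P) \<le> \<sigma>\<^sup>2"
    and variance_half:
      "\<And>k t. k \<in> {1..K} \<Longrightarrow> t < T \<Longrightarrow>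
         integrable P (\<lambda>\<omega>. (norm (grad_f (half_model (S t \<omega>) k) (\<xi> k t \<omega>)
                               - grad_F (half_model (S t \<omega>) k)))\<^sup>2)"
      "\<And>k t. k \<in> {1..K} \<Longrightarrow> t < T \<Longrightarrow>
         (\<integral>\<omega>. (norm (grad_f (half_model (S t \<omega>) k) (\<xi> k t \<omega>)
                   - grad_F (half_model (S t \<omega>) k)))\<^sup>2 \<partial>P) \<le> \<sigma>\<^sup>2"
    \<comment> \<open>bounded gradient at the iterates\<close>
    and grad_bound:
      "\<And>k t. k \<in> {1..K} \<Longrightarrow> t < T \<Longrightarrow>
         AE \<omega> in P. (norm (grad_F (worker_model (S t \<omega>) k)))\<^sup>2 \<le> M\<^sup>2"
      "\<And>k t. k \<in> {1..K} \<Longrightarrow> t < T \<Longrightarrow>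
         AE \<omega> in P. (norm (grad_F (half_model (S t \<omega>) k)))\<^sup>2 \<le> M\<^sup>2"
    \<comment> \<open>delta-approximate compressor\<close>
    and \<delta>: "0 < \<delta>" "\<delta> \<le> 1"
    and compressor: "\<And>v. (norm (Q v - v))\<^sup>2 \<le> (1 - \<delta>) * (norm v)\<^sup>2"
    \<comment> \<open>constants\<close>
    and \<alpha>: "\<alpha> = 1 - \<eta> * L / (1 - \<mu>) - 2 * \<mu>\<^sup>2 * \<eta>\<^sup>2 * L\<^sup>2 / (1 - \<mu>) ^ 4"
    and \<alpha>_pos: "\<alpha> > 0"
    and C: "C = 2 * (1 + \<delta>) * (2 - \<delta>) / (1 - sqrt (1 - \<delta>))\<^sup>2 + (1 + \<delta>) / \<delta>"
  shows "(\<forall>k \<in> {1..K}.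
            (\<forall>t < T. integrable P (\<lambda>\<omega>. (norm (grad_F (worker_model (S t \<omega>) k)))\<^sup>2)) \<and>
            (MIN t \<in> {..<T}. \<integral>\<omega>. (norm (grad_F (worker_model (S t \<omega>) k)))\<^sup>2 \<partial>P)
              \<le> 4 * (1 - \<mu>) * (F x0 - F xstar) / (\<alpha> * \<eta> * real T)
                + 2 * (1 + 2 * \<mu>\<^sup>2 * \<eta> * L / (1 - \<mu>) ^ 3) * \<eta> * L * \<sigma>\<^sup>2
                    / (\<alpha> * (1 - \<mu>) * real K)
                + (4 * C + 2 * \<alpha>) * ((1 - \<delta>) / (1 - sqrt (1 - \<delta>))\<^sup>2)
                    * (\<eta>\<^sup>2 * L\<^sup>2 * (M\<^sup>2 + \<sigma>\<^sup>2) / (\<alpha> * (1 - \<mu>)\<^sup>2)))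
       \<and> (\<forall>t < T. integrable P (\<lambda>\<omega>. (norm (grad_F (aux_model K (S t \<omega>))))\<^sup>2))
       \<and> (MIN t \<in> {..<T}. \<integral>\<omega>. (norm (grad_F (aux_model K (S t \<omega>))))\<^sup>2 \<partial>P)
              \<le> 4 * (1 - \<mu>) * (F x0 - F xstar) / (\<alpha> * \<eta> * real T)
                + 2 * (1 + 2 * \<mu>\<^sup>2 * \<eta> * L / (1 - \<mu>) ^ 3) * \<eta> * L * \<sigma>\<^sup>2
                    / (\<alpha> * (1 - \<mu>) * real K)
                + (4 / \<alpha> + 2) * (C * (1 - \<delta>) / (1 - sqrt (1 - \<delta>))\<^sup>2)
                    * (\<eta>\<^sup>2 * L\<^sup>2 * (M\<^sup>2 + \<sigma>\<^sup>2) / (1 - \<mu>)\<^sup>2)"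
proof -
  interpret run: saef_sampling P D grad_f F grad_F \<xi> Q x0 xstar K T \<mu> L \<sigma> M \<delta> \<eta> lr S
  proof (intro saef_sampling.intro saef_sampling_axioms.intro)
    \<comment> \<open>Integrability of each \<open>f x\<close> supplies the separate measurability
      from which joint measurability is built.\<close>
    show "(\<lambda>p. grad_f (fst p) (snd p)) \<in> borel_measurable (borel \<Otimes>\<^sub>M D)"
      using f_integrable grad_f by (intro gradient_borel_measurable) auto
  qed (fact assms)+
  have model: "worker_model (S t \<omega>) k = run.mdl t \<omega>" for t k \<omega>
    by (simp add: worker_model_def run.mdl_def)
  have aux: "aux_model K (S t \<omega>) = run.aux t \<omega>" for t \<omega>
    by (simp add: run.aux_model_eq run.aux_def)
  have \<alpha>': "\<alpha> = run.\<alpha>" and C': "C = run.C"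
    by (simp_all add: \<alpha> run.\<alpha>_def C run.C_def)
  have \<alpha>_pos': "0 < run.\<alpha>" using \<alpha>_pos by (simp add: \<alpha>')
  have "integrable P (\<lambda>\<omega>. (norm (grad_F (run.mdl t \<omega>)))\<^sup>2)"
    "integrable P (\<lambda>\<omega>. (norm (grad_F (run.aux t \<omega>)))\<^sup>2)" if "t < T" for t
    using that
    by (intro run.square_integrable_norm run.square_integrable_grad_F run.square_integrable_mdl
        run.square_integrable_aux; simp)+
  then show ?thesis
    using run.min_gradient_model_le[OF T \<alpha>_pos'] run.min_gradient_aux_le[OF T \<alpha>_pos']
    unfolding model aux \<alpha>' C' run.second_moment_def by blast
qed

end
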